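(* For $i=1,\dots,l$ let $U_i$ be an open subset of $\mathbb{R}^{d_i}$, $F_i:U_i\to\mathrm{Mat}_{m_i,n}$ a continuous map and $\mu_i$ a Federer measure on $U_i$, and assume that each pair $(F_i,\mu_i)$ is good and weakly non-planar. Let $\mu=\mu_1\times\dots\times\mu_l$ on $U=U_1\times\dots\times U_l$, $m=m_1+\dots+m_l$, and $F:U\to\mathrm{Mat}_{m,n}$ be given by stacking: $F(x_1,\dots,x_l)=\begin{pmatrix}F_1(x_1)\\ \vdots\\ F_l(x_l)\end{pmatrix}$. Then (a) $\mu$ is Federer, (b) $(F,\mu)$ is good, and (c) $(F,\mu)$ is weakly non-planar.
   Context: $\mathrm{Mat}_{k,l}$ denotes real $k\times l$ matrices. All measures are Radon. A measure $\mu$ is $D$-Federer on an open $U$ if $\mu(3V)<D\mu(V)$ for every ball $V\subset U$ centred in $\operatorname{supp}\mu$ (where $3B(x,r)=B(x,3r)$); $\mu$ is Federer if for $\mu$-a.e. $x$ there are a neighbourhood $U$ of $x$ and $D>0$ with $\mu$ $D$-Federer on $U$. Put $\|f\|_{\mu,V}=\sup_{x\in V\cap\operatorname{supp}\mu}|f(x)|$. $f$ is $(C,\alpha)$-good on open $U$ w.r.t. $\mu$ if for every ball $V\subset U$ centred in $\operatorname{supp}\mu$ and every $\varepsilon>0$, $\mu(\{x\in V:|f(x)|<\varepsilon\})\le C(\varepsilon/\|f\|_{\mu,V})^\alpha\mu(V)$. For $\mathbf{f}=(f_1,\dots,f_N)$, $(\mathbf{f},\mu)$ is good if for $\mu$-a.e.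 $x$ there are a neighbourhood $V$ of $x$ and $C,\alpha>0$ such that every real linear combination of $1,f_1,\dots,f_N$ is $(C,\alpha)$-good on $V$ w.r.t. $\mu$. With $\mathbf{d}:\mathrm{Mat}_{m,n}\to\mathbb{R}^{N}$, $N=\binom{m+n}{n}-1$, listing all minors of a matrix in a fixed order, $(F,\mu)$ is good if $(\mathbf{d}\circ F,\mu)$ is good. For $A\in\mathrm{Mat}_{n,m}$, $B\in\mathrm{Mat}_{n,n}$ let $\mathcal{H}_{A,B}=\{Y\in\mathrm{Mat}_{m,n}:\det(AY+B)=0\}$ and $\mathbf{H}_{m,n}$ the collection of all $\mathcal{H}_{A,B}$ with $\operatorname{rank}(A|B)=n$; $(F,\mu)$ is weakly non-planar if $F(V\cap\operatorname{supp}\mu)\not\subset\mathcal{H}$ for every ball $V$ in the domain centred in $\operatorname{supp}\mu$ and every $\mathcal{H}\in\mathbf{H}_{m,n}$ (analogously for $\mathrm{Mat}_{m_i,n}$). *)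

theory Defs
  imports
    "HOL-Analysis.Analysis"
    "Jordan_Normal_Form.DL_Rank"
    "Jordan_Normal_Form.DL_Submatrix"
begin

text \<open>
  The dimensions \<open>d i\<close>, \<open>m i\<close> vary with the index of the factor, so \<open>\<real>\<^sup>d\<close> is the set of (extensional)
  functions \<open>{..<d} \<rightarrow> \<real>\<close> with the Euclidean distance, packaged as a \<open>metric\<close>, and matrices are those of
  \<open>Jordan_Normal_Form\<close>. A product \<open>\<real>\<^bsup>d 0\<^esup> \<times> \<dots> \<times> \<real>\<^bsup>d (l - 1)\<^esup>\<close> consists of curried functions
  \<open>x i j\<close> with \<open>i < l\<close>, \<open>j < d i\<close>, which are not flattened to \<open>\<real>\<^bsup>d 0 + \<dots> + d (l - 1)\<^esup>\<close>; its metric is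
  the Euclidean one (\<open>mdist_euclid_prod\<close>), so its balls are those of the flattened space.
\<close>

definition l2_metric :: "'i set \<Rightarrow> ('i \<Rightarrow> 'a metric) \<Rightarrow> ('i \<Rightarrow> 'a) metric" where
  "l2_metric I X = metric (PiE I (\<lambda>i. mspace (X i)),
     \<lambda>x y. L2_set (\<lambda>i. mdist (X i) (x i) (y i)) I)"

definition euclid :: "nat \<Rightarrow> (nat \<Rightarrow> real) metric" where
  "euclid d = l2_metric {..<d} (\<lambda>_. euclidean_metric)"

definition euclid_prod :: "nat \<Rightarrow> (nat \<Rightarrow> nat) \<Rightarrow> (nat \<Rightarrow> nat \<Rightarrow> real) metric" where
  "euclid_prod l d = l2_metric {..<l} (\<lambda>i. euclid (d i))"

lemma Metric_space_l2:
  assumes fin: "finite I"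
  shows "Metric_space (PiE I (\<lambda>i. mspace (X i))) (\<lambda>x y. L2_set (\<lambda>i. mdist (X i) (x i) (y i)) I)"
proof
  fix x y z
  show "0 \<le> L2_set (\<lambda>i. mdist (X i) (x i) (y i)) I"
    by simp
  show "L2_set (\<lambda>i. mdist (X i) (x i) (y i)) I = L2_set (\<lambda>i. mdist (X i) (y i) (x i)) I"
    by (simp add: mdist_commute)
  assume x: "x \<in> PiE I (\<lambda>i. mspace (X i))" and y: "y \<in> PiE I (\<lambda>i. mspace (X i))"
  then have "\<And>i. i \<in> I \<Longrightarrow> x i \<in> mspace (X i) \<and> y i \<in> mspace (X i)"
    by blast
  then have "L2_set (\<lambda>i. mdist (X i) (x i) (y i)) I = 0 \<longleftrightarrow> (\<forall>i\<in>I. x i = y i)"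
    using fin by (auto simp: L2_set_eq_0_iff)
  then show "L2_set (\<lambda>i. mdist (X i) (x i) (y i)) I = 0 \<longleftrightarrow> x = y"
    using x y by (auto intro: PiE_ext)
  assume z: "z \<in> PiE I (\<lambda>i. mspace (X i))"
  have "L2_set (\<lambda>i. mdist (X i) (x i) (z i)) I
      \<le> L2_set (\<lambda>i. mdist (X i) (x i) (y i) + mdist (X i) (y i) (z i)) I"
  proof (rule L2_set_mono)
    fix i assume "i \<in> I"
    then show "mdist (X i) (x i) (z i) \<le> mdist (X i) (x i) (y i) + mdist (X i) (y i) (z i)"
      using x y z by (intro mdist_triangle) auto
  qed simp
  also have "\<dots> \<le> L2_set (\<lambda>i. mdist (X i) (x i) (y i)) I + L2_set (\<lambda>i. mdist (X i) (y i) (z i)) I"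
    by (rule L2_set_triangle_ineq)
  finally show "L2_set (\<lambda>i. mdist (X i) (x i) (z i)) I
      \<le> L2_set (\<lambda>i. mdist (X i) (x i) (y i)) I + L2_set (\<lambda>i. mdist (X i) (y i) (z i)) I" .
qed

lemma mspace_l2_metric: "finite I \<Longrightarrow> mspace (l2_metric I X) = PiE I (\<lambda>i. mspace (X i))"
  by (simp add: l2_metric_def Metric_space.mspace_metric Metric_space_l2)

lemma mdist_l2_metric:
  "finite I \<Longrightarrow> mdist (l2_metric I X) = (\<lambda>x y. L2_set (\<lambda>i. mdist (X i) (x i) (y i)) I)"
  by (simp add: l2_metric_def Metric_space.mdist_metric Metric_space_l2)

lemma mspace_euclid: "mspace (euclid d) = PiE {..<d} (\<lambda>_. UNIV)"
  by (simp add: euclid_def mspace_l2_metric)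

lemma mdist_euclid: "mdist (euclid d) x y = sqrt (\<Sum>j<d. (x j - y j)\<^sup>2)"
  by (simp add: euclid_def mdist_l2_metric L2_set_def dist_real_def)

lemma mspace_euclid_prod:
  "mspace (euclid_prod l d) = PiE {..<l} (\<lambda>i. PiE {..<d i} (\<lambda>_. UNIV))"
  by (simp add: euclid_prod_def mspace_l2_metric mspace_euclid)

lemma mdist_euclid_prod:
  "mdist (euclid_prod l d) x y = sqrt (\<Sum>i<l. \<Sum>j<d i. (x i j - y i j)\<^sup>2)"
  by (simp add: euclid_prod_def mdist_l2_metric mdist_euclid L2_set_def sum_nonneg)

text \<open>
  A measure on an open subset \<open>U\<close> of \<open>X\<close> has \<open>space \<mu> = U\<close>. Balls are open balls of \<open>X\<close>, given by
  centre and radius.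
\<close>

definition radon_measure_on :: "'a metric \<Rightarrow> 'a set \<Rightarrow> 'a measure \<Rightarrow> bool" where
  "radon_measure_on X U \<mu> \<longleftrightarrow>
     space \<mu> = U \<and>
     sets \<mu> = sigma_sets U {W. openin (subtopology (mtopology_of X) U) W} \<and>
     (\<forall>x\<in>U. \<exists>W. openin (subtopology (mtopology_of X) U) W \<and> x \<in> W \<and> emeasure \<mu> W < \<infinity>) \<and>
     (\<forall>S\<in>sets \<mu>. emeasure \<mu> S =
        (SUP K \<in> {K. compactin (mtopology_of X) K \<and> K \<subseteq> S}. emeasure \<mu> K))"

definition msupport :: "'a metric \<Rightarrow> 'a measure \<Rightarrow> 'a set" where
  "msupport X \<mu> = {x \<in> space \<mu>. \<forall>r>0. emeasure \<mu> (mball_of X x r \<inter> space \<mu>) > 0}"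

text \<open>
  The ball \<open>3V\<close> may leave the set on which \<open>\<mu>\<close> lives; the part outside it does not count.
\<close>

definition federer_const_on :: "'a metric \<Rightarrow> 'a measure \<Rightarrow> real \<Rightarrow> 'a set \<Rightarrow> bool" where
  "federer_const_on X \<mu> D W \<longleftrightarrow>
     (\<forall>x\<in>msupport X \<mu>. \<forall>r>0. mball_of X x r \<subseteq> W \<longrightarrow>
        emeasure \<mu> (mball_of X x (3 * r) \<inter> space \<mu>) < ennreal D * emeasure \<mu> (mball_of X x r))"

definition federer_measure_on :: "'a metric \<Rightarrow> 'a set \<Rightarrow> 'a measure \<Rightarrow> bool" where
  "federer_measure_on X U \<mu> \<longleftrightarrow>
     radon_measure_on X U \<mu> \<and>
     (AE x in \<mu>. \<exists>W D. openin (mtopology_of X) W \<and> x \<in> W \<and> W \<subseteq> U \<and> D > 0 \<and>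
        federer_const_on X \<mu> D W)"

definition sup_norm_on :: "'a metric \<Rightarrow> 'a measure \<Rightarrow> 'a set \<Rightarrow> ('a \<Rightarrow> real) \<Rightarrow> ennreal" where
  "sup_norm_on X \<mu> V f = (SUP x \<in> V \<inter> msupport X \<mu>. ennreal \<bar>f x\<bar>)"

text \<open>
  The quotient \<open>\<epsilon> / \<parallel>f\<parallel>\<close> is taken in \<open>[0, \<infinity>]\<close>: it is \<open>\<infinity>\<close> if \<open>f\<close> vanishes on \<open>V \<inter> supp \<mu>\<close> (the condition
  is then void, in particular the zero function is good) and \<open>0\<close> if \<open>f\<close> is unbounded there.
  With real division both conventions would come out wrong.
\<close>

definition ennpowr :: "ennreal \<Rightarrow> real \<Rightarrow> ennreal" where
  "ennpowr t \<alpha> = (if t = \<infinity> then \<infinity> else ennreal (enn2real t powr \<alpha>))"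

definition good_on :: "'a metric \<Rightarrow> 'a measure \<Rightarrow> real \<Rightarrow> real \<Rightarrow> 'a set \<Rightarrow> ('a \<Rightarrow> real) \<Rightarrow> bool" where
  "good_on X \<mu> C \<alpha> W f \<longleftrightarrow>
     (\<forall>x\<in>msupport X \<mu>. \<forall>r>0. mball_of X x r \<subseteq> W \<longrightarrow>
        (\<forall>\<epsilon>>0. emeasure \<mu> {y \<in> mball_of X x r. \<bar>f y\<bar> < \<epsilon>}
           \<le> ennreal C * ennpowr (ennreal \<epsilon> / sup_norm_on X \<mu> (mball_of X x r) f) \<alpha>
               * emeasure \<mu> (mball_of X x r)))"

text \<open>
  A tuple \<open>(f\<^sub>1, \<dots>, f\<^sub>N)\<close> is a family indexed by a finite set \<open>K\<close>; its order is irrelevant here.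
\<close>

definition good_tuple :: "'a metric \<Rightarrow> 'a measure \<Rightarrow> 'k set \<Rightarrow> ('k \<Rightarrow> 'a \<Rightarrow> real) \<Rightarrow> bool" where
  "good_tuple X \<mu> K f \<longleftrightarrow>
     (AE x in \<mu>. \<exists>W C \<alpha>. openin (mtopology_of X) W \<and> x \<in> W \<and> W \<subseteq> space \<mu> \<and> C > 0 \<and> \<alpha> > 0 \<and>
        (\<forall>c0 c. good_on X \<mu> C \<alpha> W (\<lambda>y. c0 + (\<Sum>k\<in>K. c k * f k y))))"

definition minor_index :: "nat \<Rightarrow> nat \<Rightarrow> (nat set \<times> nat set) set" where
  "minor_index m n = {(I, J). I \<subseteq> {..<m} \<and> J \<subseteq> {..<n} \<and> card I = card J \<and> I \<noteq> {}}"

definition minor :: "'a::comm_ring_1 mat \<Rightarrow> nat set \<times> nat set \<Rightarrow> 'a" where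
  "minor Y = (\<lambda>(I, J). Determinant.det (submatrix Y I J))"

definition good_map :: "'a metric \<Rightarrow> 'a measure \<Rightarrow> nat \<Rightarrow> nat \<Rightarrow> ('a \<Rightarrow> real mat) \<Rightarrow> bool" where
  "good_map X \<mu> m n F \<longleftrightarrow> good_tuple X \<mu> (minor_index m n) (\<lambda>k x. minor (F x) k)"

definition continuous_mat_on ::
  "'a metric \<Rightarrow> 'a set \<Rightarrow> nat \<Rightarrow> nat \<Rightarrow> ('a \<Rightarrow> real mat) \<Rightarrow> bool" where
  "continuous_mat_on X U m n F \<longleftrightarrow>
     F \<in> U \<rightarrow> carrier_mat m n \<and>
     (\<forall>r<m. \<forall>c<n. continuous_map (subtopology (mtopology_of X) U) euclideanreal (\<lambda>x. F x $$ (r, c)))"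

definition append_cols :: "'a::zero mat \<Rightarrow> 'a mat \<Rightarrow> 'a mat" where
  "append_cols A B = four_block_mat A B (0\<^sub>m 0 (dim_col A)) (0\<^sub>m 0 (dim_col B))"

definition det_hypersurface :: "nat \<Rightarrow> nat \<Rightarrow> real mat \<Rightarrow> real mat \<Rightarrow> real mat set" where
  "det_hypersurface m n A B = {Y \<in> carrier_mat m n. Determinant.det (A * Y + B) = 0}"

definition det_hypersurfaces :: "nat \<Rightarrow> nat \<Rightarrow> real mat set set" where
  "det_hypersurfaces m n =
     {det_hypersurface m n A B | A B. A \<in> carrier_mat n m \<and> B \<in> carrier_mat n n \<and>
        vec_space.rank n (append_cols A B) = n}"

definition weakly_nonplanar ::
  "'a metric \<Rightarrow> 'a measure \<Rightarrow> nat \<Rightarrow> nat \<Rightarrow> ('a \<Rightarrow> real mat) \<Rightarrow> bool" where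
  "weakly_nonplanar X \<mu> m n F \<longleftrightarrow>
     (\<forall>x\<in>msupport X \<mu>. \<forall>r>0. mball_of X x r \<subseteq> space \<mu> \<longrightarrow>
        (\<forall>H\<in>det_hypersurfaces m n. \<not> F ` (mball_of X x r \<inter> msupport X \<mu>) \<subseteq> H))"

definition stack_rows :: "nat \<Rightarrow> real mat list \<Rightarrow> real mat" where
  "stack_rows n Ys = foldr append_rows Ys (0\<^sub>m 0 n)"

end

theory Submission
  imports Defs
begin

text \<open>
  Euclidean balls of the product compare with boxes: a ball of radius \<open>r\<close> lies in
  the box of balls of radius \<open>r\<close> and contains the box of balls of radius \<open>r / 3\<^sup>l\<close>, and the
  Federer property of the factors makes these boxes comparable in measure. For goodness, a linear
  combination of minors of the stacked matrix is, in each block separately, a linear combination of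
  \<open>1\<close> and the minors of that block (Laplace expansion), so it is good in each variable; moving from
  a point where the function is large to one where it is small, one block at a time, some step has to
  account for an \<open>l\<close>-th root of the drop. For nonplanarity, \<open>rank (A|B) = n\<close> means that
  \<open>det (A Y + B)\<close> does not vanish identically in \<open>Y\<close>, and the blocks of a good \<open>Y\<close> can be replaced
  successively by values of the \<open>F\<^sub>i\<close>.
\<close>

text \<open>Frozen coordinates may thus be arbitrary points of the neighbourhood, as they have to
  be: the intermediate points of the chain take coordinates from y, and y need not lie in the
  support. The sup norm, on the other hand, sees only the support. The chain starts at a support
  point p, so the slice in direction j passes through the support point p_j, where the large value
  is found.

  Ball and box are never compared through sup norms. The sublevel set in the ball is enlarged to the
  circumscribed box, while p is taken in the ball itself, so the only loss is a ratio of two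
  measures. That ratio is controlled by tripling radii, which is why the inscribed box is scaled by
  a power of 3 and not by the sharper square root of l.\<close>

unbundle no inner_syntax and no vec_syntax

section \<open>Minors of stacked matrices\<close>

lemma stack_rows_Cons: "stack_rows n (Y # Ys) = Y @\<^sub>r stack_rows n Ys"
  by (simp add: stack_rows_def)

lemma stack_rows_Nil: "stack_rows n [] = 0\<^sub>m 0 n"
  by (simp add: stack_rows_def)

lemma stack_rows_carrier:
  "list_all2 (\<lambda>m Y. Y \<in> carrier_mat m n) ms Ys \<Longrightarrow> stack_rows n Ys \<in> carrier_mat (sum_list ms) n"
  by (induction rule: list_all2_induct) (auto simp: stack_rows_Cons stack_rows_Nil)

lemma stack_rows_map_carrier:
  assumes "\<And>i. i < l \<Longrightarrow> Y i \<in> carrier_mat (m i) n"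
  shows "stack_rows n (map Y [0..<l]) \<in> carrier_mat (\<Sum>i<l. m i) n"
  using stack_rows_carrier[of n "map m [0..<l]" "map Y [0..<l]"] assms
  by (simp add: list_all2_conv_all_nth interv_sum_list_conv_sum_set_nat atLeast0LessThan)

lemma append_rows_index:
  assumes "A \<in> carrier_mat p n" "B \<in> carrier_mat q n" "r < p + q" "c < n"
  shows "(A @\<^sub>r B) $$ (r, c) = (if r < p then A $$ (r, c) else B $$ (r - p, c))"
  using assms unfolding append_rows_def by auto

lemma stack_rows_index:
  assumes "\<And>i. i < l \<Longrightarrow> Y i \<in> carrier_mat (m i) n" "j < l" "r < m j" "c < n"
  shows "stack_rows n (map Y [0..<l]) $$ ((\<Sum>i<j. m i) + r, c) = Y j $$ (r, c)"
  using assms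
proof (induction l arbitrary: Y m j)
  case (Suc l)
  have Y: "Y 0 \<in> carrier_mat (m 0) n" "\<And>i. i < l \<Longrightarrow> Y (Suc i) \<in> carrier_mat (m (Suc i)) n"
    using Suc.prems(1) by auto
  have st: "stack_rows n (map (\<lambda>i. Y (Suc i)) [0..<l]) \<in> carrier_mat (\<Sum>i<l. m (Suc i)) n"
    by (rule stack_rows_map_carrier) (fact Y(2))
  have eq: "stack_rows n (map Y [0..<Suc l]) = Y 0 @\<^sub>r stack_rows n (map (\<lambda>i. Y (Suc i)) [0..<l])"
    by (simp add: upt_conv_Cons map_Suc_upt[symmetric] o_def stack_rows_Cons del: upt_Suc)
  show ?case
  proof (cases j)
    case 0
    then show ?thesis
      using Suc.prems by (simp add: eq append_rows_index[OF Y(1) st] del: upt_Suc)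
  next
    case (Suc j')
    have "(\<Sum>i<j'. m (Suc i)) + r < (\<Sum>i<Suc j'. m (Suc i))"
      using Suc.prems Suc by simp
    also have "\<dots> \<le> (\<Sum>i<l. m (Suc i))"
      using Suc.prems Suc by (intro sum_mono2) auto
    finally have "(\<Sum>i<j'. m (Suc i)) + r < (\<Sum>i<l. m (Suc i))" .
    then show ?thesis
      using Suc.prems Suc Suc.IH[of "\<lambda>i. Y (Suc i)" "\<lambda>i. m (Suc i)" j', OF Y(2)]
      by (simp add: eq append_rows_index[OF Y(1) st] sum.lessThan_Suc_shift del: upt_Suc sum.lessThan_Suc)
  qed
qed simp

lemma lessThan_sum_cases:
  fixes m :: "nat \<Rightarrow> nat"
  assumes "r < (\<Sum>i<l. m i)"
  obtains j r' where "j < l" "r' < m j" "r = (\<Sum>i<j. m i) + r'"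
  using assms
proof (induction l)
  case (Suc l)
  show ?case
  proof (cases "r < (\<Sum>i<l. m i)")
    case True
    then show ?thesis using Suc.IH Suc.prems(1) less_Suc_eq by blast
  next
    case False
    then show ?thesis
      using Suc.prems(1)[of l "r - (\<Sum>i<l. m i)"] Suc.prems(2) by simp
  qed
qed simp

text \<open>\<open>pick\<close> enumerates a set increasingly, so it recovers any increasing
  parametrisation of that set. Index sets can thus be traded for increasing index maps, the form in
  which the Laplace induction deletes rows and columns by composition.\<close>

lemma pick_image_strict_mono:
  fixes \<rho> :: "nat \<Rightarrow> nat"
  assumes "strict_mono_on {..<k} \<rho>" "a < k"
  shows "pick (\<rho> ` {..<k}) a = \<rho> a"
proof -
  have inj: "inj_on \<rho> {..<k}"
    using assms(1) by (simp add: strict_mono_on_imp_inj_on)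
  have "{b \<in> \<rho> ` {..<k}. b < \<rho> a} = \<rho> ` {..<a}"
    using assms strict_mono_on_less[OF assms(1)] by (auto simp: image_iff)
  moreover have "card (\<rho> ` {..<a}) = a"
    using inj_on_subset[OF inj, of "{..<a}"] assms(2) by (simp add: card_image)
  ultimately show ?thesis
    using pick_card_in_set[of "\<rho> a" "\<rho> ` {..<k}"] assms(2) by auto
qed

lemma minor_image_strict_mono:
  assumes "strict_mono_on {..<k} \<rho>" "strict_mono_on {..<k} \<gamma>" "\<rho> ` {..<k} \<subseteq> {..<m}" "\<gamma> ` {..<k} \<subseteq> {..<n}"
    and Y: "Y \<in> carrier_mat m n"
  shows "minor Y (\<rho> ` {..<k}, \<gamma> ` {..<k}) = Determinant.det (Matrix.mat k k (\<lambda>(a, b). Y $$ (\<rho> a, \<gamma> b)))"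
proof -
  have "{i. i < dim_row Y \<and> i \<in> \<rho> ` {..<k}} = \<rho> ` {..<k}" "{i. i < dim_col Y \<and> i \<in> \<gamma> ` {..<k}} = \<gamma> ` {..<k}"
    using assms by auto
  moreover have "card (\<rho> ` {..<k}) = k" "card (\<gamma> ` {..<k}) = k"
    using assms by (simp_all add: card_image strict_mono_on_imp_inj_on)
  ultimately have "submatrix Y (\<rho> ` {..<k}) (\<gamma> ` {..<k}) = Matrix.mat k k (\<lambda>(a, b). Y $$ (\<rho> a, \<gamma> b))"
    unfolding submatrix_def using assms by (intro eq_matI) (auto simp: pick_image_strict_mono)
  then show ?thesis
    by (simp add: minor_def)
qed

text \<open>The span of 1 and the minors, over which \<open>good_map\<close> quantifies, as a class
  closed under the operations that occur in a Laplace expansion.\<close>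

definition affine_in_minors :: "nat \<Rightarrow> nat \<Rightarrow> (real mat \<Rightarrow> real) \<Rightarrow> bool" where
  "affine_in_minors m n \<phi> \<longleftrightarrow>
     (\<exists>c0 c. \<forall>Y\<in>carrier_mat m n. \<phi> Y = c0 + (\<Sum>k\<in>minor_index m n. c k * minor Y k))"

lemma finite_minor_index: "finite (minor_index m n)"
  by (rule finite_subset[of _ "Pow {..<m} \<times> Pow {..<n}"]) (auto simp: minor_index_def)

lemma affine_in_minors_const: "affine_in_minors m n (\<lambda>_. a)"
  unfolding affine_in_minors_def by (rule exI[of _ a], rule exI[of _ "\<lambda>_. 0"]) simp

lemma affine_in_minors_minor:
  assumes "k \<in> minor_index m n"
  shows "affine_in_minors m n (\<lambda>Y. minor Y k)"
  unfolding affine_in_minors_def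
  by (rule exI[of _ 0], rule exI[of _ "\<lambda>k'. if k' = k then 1 else 0"])
    (use assms in \<open>simp add: finite_minor_index if_distrib[of "\<lambda>y. y * _"] sum.delta cong: if_cong\<close>)

lemma affine_in_minors_add:
  assumes "affine_in_minors m n \<phi>" "affine_in_minors m n \<psi>"
  shows "affine_in_minors m n (\<lambda>Y. \<phi> Y + \<psi> Y)"
proof -
  obtain c0 c where c: "\<And>Y. Y \<in> carrier_mat m n \<Longrightarrow> \<phi> Y = c0 + (\<Sum>k\<in>minor_index m n. c k * minor Y k)"
    using assms(1) unfolding affine_in_minors_def by blast
  obtain e0 e where e: "\<And>Y. Y \<in> carrier_mat m n \<Longrightarrow> \<psi> Y = e0 + (\<Sum>k\<in>minor_index m n. e k * minor Y k)"
    using assms(2) unfolding affine_in_minors_def by blast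
  show ?thesis
    unfolding affine_in_minors_def
    by (rule exI[of _ "c0 + e0"], rule exI[of _ "\<lambda>k. c k + e k"]) (simp add: c e algebra_simps sum.distrib)
qed

lemma affine_in_minors_cmult:
  assumes "affine_in_minors m n \<phi>"
  shows "affine_in_minors m n (\<lambda>Y. a * \<phi> Y)"
proof -
  obtain c0 c where c: "\<And>Y. Y \<in> carrier_mat m n \<Longrightarrow> \<phi> Y = c0 + (\<Sum>k\<in>minor_index m n. c k * minor Y k)"
    using assms unfolding affine_in_minors_def by blast
  show ?thesis
    unfolding affine_in_minors_def
    by (rule exI[of _ "a * c0"], rule exI[of _ "\<lambda>k. a * c k"]) (simp add: c algebra_simps sum_distrib_left)
qed

lemma affine_in_minors_sum:
  assumes "\<And>k. k \<in> K \<Longrightarrow> affine_in_minors m n (\<phi> k)"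
  shows "affine_in_minors m n (\<lambda>Y. \<Sum>k\<in>K. \<phi> k Y)"
  using assms
  by (induction K rule: infinite_finite_induct) (auto intro: affine_in_minors_add affine_in_minors_const)

lemma affine_in_minors_cong:
  assumes "affine_in_minors m n \<phi>" "\<And>Y. Y \<in> carrier_mat m n \<Longrightarrow> \<psi> Y = \<phi> Y"
  shows "affine_in_minors m n \<psi>"
  using assms unfolding affine_in_minors_def by simp

text \<open>Laplace expansion along the constant rows leaves minors of \<open>Y\<close>.\<close>

lemma affine_in_minors_det:
  assumes "S \<subseteq> {..<k}" "strict_mono_on S \<rho>" "\<rho> ` S \<subseteq> {..<m}"
    and "strict_mono_on {..<k} \<gamma>" "\<gamma> ` {..<k} \<subseteq> {..<n}"
  shows "affine_in_minors m n (\<lambda>Y. Determinant.det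
    (Matrix.mat k k (\<lambda>(a, b). if a \<in> S then Y $$ (\<rho> a, \<gamma> b) else E a b)))"
  using assms
proof (induction k arbitrary: S \<rho> \<gamma> E)
  \<comment> \<open>The empty determinant is 1. It is absorbed by the constant term, since
    \<open>minor_index\<close> excludes the empty minor.\<close>
  case 0
  then show ?case
    by (simp add: affine_in_minors_const)
next
  case (Suc k)
  show ?case
  proof (cases "S = {..<Suc k}")
    case True
    have "(\<rho> ` {..<Suc k}, \<gamma> ` {..<Suc k}) \<in> minor_index m n"
      using Suc.prems True by (auto simp: minor_index_def card_image strict_mono_on_imp_inj_on)
    moreover have "Determinant.det (Matrix.mat (Suc k) (Suc k) (\<lambda>(a, b). if a \<in> S then Y $$ (\<rho> a, \<gamma> b) else E a b))
        = minor Y (\<rho> ` {..<Suc k}, \<gamma> ` {..<Suc k})" if "Y \<in> carrier_mat m n" for Y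
    proof -
      have "Matrix.mat (Suc k) (Suc k) (\<lambda>(a, b). if a \<in> S then Y $$ (\<rho> a, \<gamma> b) else E a b) =
          Matrix.mat (Suc k) (Suc k) (\<lambda>(a, b). Y $$ (\<rho> a, \<gamma> b))"
        using True by (intro eq_matI) auto
      then show ?thesis
        using Suc.prems True that by (subst minor_image_strict_mono[of _ _ _ m n]) auto
    qed
    ultimately show ?thesis
      by (rule affine_in_minors_cong[OF affine_in_minors_minor])
  next
    case False
    then obtain a0 where a0: "a0 < Suc k" "a0 \<notin> S"
      using Suc.prems(1) by auto
    define M where "M = (\<lambda>Y. Matrix.mat (Suc k) (Suc k) (\<lambda>(a, b). if a \<in> S then Y $$ (\<rho> a, \<gamma> b) else E a b))"
    have M: "M Y \<in> carrier_mat (Suc k) (Suc k)" for Y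
      by (simp add: M_def)
    have mono_ins: "strict_mono (insert_index i)" for i
      by (intro strict_monoI) (auto simp: insert_index_def)
    have ins: "insert_index i a < Suc k" if "i < Suc k" "a < k" for i a
      using that by (auto simp: insert_index_def)
    have "affine_in_minors m n (\<lambda>Y. Determinant.det (mat_delete (M Y) a0 b0))" if b0: "b0 < Suc k" for b0
    proof -
      \<comment> \<open>Deleting row \<open>a0\<close> and column \<open>b0\<close> renumbers
        through the increasing maps \<open>insert_index a0\<close> and
        \<open>insert_index b0\<close>. The result has the same shape with these maps composed into
        the index maps and the constant entries, hence the induction over all of them.\<close>
      define S' where "S' = {a. a < k \<and> insert_index a0 a \<in> S}"
      have "mat_delete (M Y) a0 b0 = Matrix.mat k k (\<lambda>(a, b). if a \<in> S'
          then Y $$ ((\<rho> \<circ> insert_index a0) a, (\<gamma> \<circ> insert_index b0) b)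
          else E (insert_index a0 a) (insert_index b0 b))" for Y
        using M[of Y] a0 b0 ins
        by (intro eq_matI)
          (auto simp: mat_delete_index[OF M a0(1) b0, symmetric] S'_def mat_delete_carrier, auto simp: M_def mat_delete_def)
      moreover have "affine_in_minors m n (\<lambda>Y. Determinant.det (Matrix.mat k k (\<lambda>(a, b). if a \<in> S'
          then Y $$ ((\<rho> \<circ> insert_index a0) a, (\<gamma> \<circ> insert_index b0) b)
          else E (insert_index a0 a) (insert_index b0 b))))"
      proof (rule Suc.IH)
        show "strict_mono_on S' (\<rho> \<circ> insert_index a0)" "strict_mono_on {..<k} (\<gamma> \<circ> insert_index b0)"
          using Suc.prems(2,4) mono_ins ins b0 unfolding strict_mono_on_def strict_mono_def by (auto simp: S'_def)
        show "(\<gamma> \<circ> insert_index b0) ` {..<k} \<subseteq> {..<n}"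
          using Suc.prems(5) ins b0 by fastforce
      qed (use Suc.prems(3) in \<open>auto simp: S'_def\<close>)
      ultimately show ?thesis
        by simp
    qed
    then have "affine_in_minors m n (\<lambda>Y. \<Sum>b<Suc k. E a0 b * ((-1) ^ (a0 + b) * Determinant.det (mat_delete (M Y) a0 b)))"
      by (intro affine_in_minors_sum affine_in_minors_cmult) auto
    moreover have "Determinant.det (M Y) = (\<Sum>b<Suc k. E a0 b * ((-1) ^ (a0 + b) * Determinant.det (mat_delete (M Y) a0 b)))" for Y
      unfolding laplace_expansion_row[OF M a0(1)] cofactor_def
      using a0 by (intro sum.cong) (auto simp: M_def)
    ultimately show ?thesis
      unfolding M_def by simp
  qed
qed

text \<open>Each row selected by \<open>k\<close> lies either in block \<open>i\<close>, hence is a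
  row of \<open>Z\<close>, or in another block, hence does not depend on \<open>Z\<close>. The
  determinant is therefore of the mixed kind covered by \<open>affine_in_minors_det\<close>.\<close>

lemma affine_in_minors_stack_rows:
  assumes Y: "\<And>j. j < l \<Longrightarrow> Y j \<in> carrier_mat (m j) n" and i: "i < l"
    and k: "k \<in> minor_index (\<Sum>j<l. m j) n"
  shows "affine_in_minors (m i) n (\<lambda>Z. minor (stack_rows n (map (Y(i := Z)) [0..<l])) k)"
proof -
  obtain I J where IJ: "k = (I, J)" "I \<subseteq> {..<(\<Sum>j<l. m j)}" "J \<subseteq> {..<n}" "card I = card J"
    using k by (auto simp: minor_index_def)
  have fin: "finite I" "finite J"
    using IJ finite_subset by auto
  define p where "p = card I"
  define off where "off = (\<Sum>j<i. m j)"
  \<comment> \<open>Positions, in the increasing enumeration of \<open>I\<close>, of the rows that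
    fall in block \<open>i\<close>; subtracting \<open>off\<close> turns such a row number into one
    of \<open>Z\<close>.\<close>
  define S where "S = {a. a < p \<and> off \<le> pick I a \<and> pick I a < off + m i}"
  have pickI: "pick I a \<in> I" if "a < p" for a
    using that by (auto simp: p_def intro: pick_in_set_le)
  have pickJ: "pick J a \<in> J" if "a < p" for a
    using that IJ(4) by (auto simp: p_def intro: pick_in_set_le)
  have "affine_in_minors (m i) n (\<lambda>Z. Determinant.det (Matrix.mat p p
      (\<lambda>(a, b). if a \<in> S then Z $$ (pick I a - off, pick J b)
        else stack_rows n (map Y [0..<l]) $$ (pick I a, pick J b))))"
  proof (rule affine_in_minors_det)
    show "strict_mono_on S (\<lambda>a. pick I a - off)"
      using pick_mono_le[of _ I] by (auto intro!: strict_mono_onI diff_less_mono simp: S_def p_def)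
    show "strict_mono_on {..<p} (pick J)"
      using pick_mono_le[of _ J] IJ(4) by (auto intro!: strict_mono_onI simp: p_def)
    show "pick J ` {..<p} \<subseteq> {..<n}"
      using pickJ IJ(3) by auto
  qed (auto simp: S_def)
  moreover have "minor (stack_rows n (map (Y(i := Z)) [0..<l])) k = Determinant.det (Matrix.mat p p
      (\<lambda>(a, b). if a \<in> S then Z $$ (pick I a - off, pick J b)
        else stack_rows n (map Y [0..<l]) $$ (pick I a, pick J b)))" if Z: "Z \<in> carrier_mat (m i) n" for Z
  proof -
    have YZ: "(Y(i := Z)) j \<in> carrier_mat (m j) n" if "j < l" for j
      using Y Z that by simp
    have st: "stack_rows n (map (Y(i := Z)) [0..<l]) \<in> carrier_mat (\<Sum>j<l. m j) n"
      by (rule stack_rows_map_carrier) (rule YZ)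
    have entry: "stack_rows n (map (Y(i := Z)) [0..<l]) $$ (r, c) =
        (if off \<le> r \<and> r < off + m i then Z $$ (r - off, c) else stack_rows n (map Y [0..<l]) $$ (r, c))"
      if r: "r < (\<Sum>j<l. m j)" and c: "c < n" for r c
    proof -
      obtain j r' where j: "j < l" "r' < m j" "r = (\<Sum>j<j. m j) + r'"
        using lessThan_sum_cases[OF r] by blast
      have le: "(\<Sum>j<j1. m j) + m j1 \<le> (\<Sum>j<j2. m j)" if "j1 < j2" for j1 j2
        using sum_mono2[of "{..<j2}" "{..<Suc j1}" m] that by simp
      have "j = i \<longleftrightarrow> off \<le> r \<and> r < off + m i"
        using j le[of i j] le[of j i] by (cases j i rule: linorder_cases) (auto simp: off_def)
      moreover have "stack_rows n (map (Y(i := Z)) [0..<l]) $$ (r, c) = (Y(i := Z)) j $$ (r', c)"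
        unfolding j(3) by (rule stack_rows_index) (use j c YZ in auto)
      moreover have "stack_rows n (map Y [0..<l]) $$ (r, c) = Y j $$ (r', c)"
        unfolding j(3) by (rule stack_rows_index) (use j c Y in auto)
      ultimately show ?thesis
        using j(3) by (auto simp: off_def)
    qed
    have "{r. r < dim_row (stack_rows n (map (Y(i := Z)) [0..<l])) \<and> r \<in> I} = I"
      "{c. c < dim_col (stack_rows n (map (Y(i := Z)) [0..<l])) \<and> c \<in> J} = J"
      using st IJ by auto
    then have "submatrix (stack_rows n (map (Y(i := Z)) [0..<l])) I J = Matrix.mat p p
      (\<lambda>(a, b). if a \<in> S then Z $$ (pick I a - off, pick J b)
        else stack_rows n (map Y [0..<l]) $$ (pick I a, pick J b))"
      unfolding submatrix_def using IJ pickI pickJ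
      by (intro eq_matI) (auto simp: p_def S_def entry subset_eq)
    then show ?thesis
      by (simp add: minor_def IJ)
  qed
  ultimately show ?thesis
    by (rule affine_in_minors_cong)
qed

section \<open>Full rank and nonvanishing determinants\<close>

lemma scalar_prod_self_eq_0_iff:
  fixes v :: "real vec"
  assumes "v \<in> carrier_vec n"
  shows "v \<bullet> v = 0 \<longleftrightarrow> v = 0\<^sub>v n"
proof
  assume "v \<bullet> v = 0"
  then have "\<forall>i<n. v $ i = 0"
    using assms sum_nonneg_eq_0_iff[of "{0..<n}" "\<lambda>i. v $ i * v $ i"] by (auto simp: scalar_prod_def)
  then show "v = 0\<^sub>v n"
    using assms by (intro eq_vecI) auto
qed simp

lemma (in vec_space) rank_eq_n_iff:
  assumes A: "A \<in> carrier_mat n nc"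
  shows "rank A = n \<longleftrightarrow> col_space A = carrier_vec n"
proof
  assume r: "rank A = n"
  have sub: "set (cols A) \<subseteq> carrier_vec n"
    using A cols_dim by blast
  obtain S where S: "maximal S (\<lambda>T. T \<subseteq> set (cols A) \<and> lin_indpt T)"
    using maximal_exists_superset[of "set (cols A)" "\<lambda>T. T \<subseteq> set (cols A) \<and> lin_indpt T" "{}"]
    by (metis (no_types, lifting) List.finite_set finite_lin_indpt2 empty_iff empty_subsetI finite.emptyI lindep_span)
  then have S': "S \<subseteq> set (cols A)" "lin_indpt S"
    by (auto simp: maximal_def)
  have "card S = n"
    using rank_card_indpt[OF A S] r by simp
  then have "basis S"
    using S' sub fin_dim finite_subset[OF S'(1)] by (intro dim_li_is_basis) (auto simp: dim_is_n)
  then have "span S = carrier_vec n"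
    by (simp add: basis_def)
  then show "col_space A = carrier_vec n"
    using span_is_monotone[OF S'(1)] sub span_closed unfolding col_space_def by blast
next
  assume "col_space A = carrier_vec n"
  then have "span_vs (set (cols A)) = V"
    unfolding col_space_def by simp
  then show "rank A = n"
    unfolding rank_def by (simp add: dim_is_n)
qed

lemma append_cols_mult_vec:
  assumes "A \<in> carrier_mat k m" "B \<in> carrier_mat k n" "a \<in> carrier_vec m" "b \<in> carrier_vec n"
  shows "append_cols A B *\<^sub>v (a @\<^sub>v b) = A *\<^sub>v a + B *\<^sub>v b"
proof -
  have "append_cols A B *\<^sub>v (a @\<^sub>v b) = (A *\<^sub>v a + B *\<^sub>v b) @\<^sub>v (0\<^sub>m 0 m *\<^sub>v a + 0\<^sub>m 0 n *\<^sub>v b)"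
    using assms unfolding append_cols_def by (subst four_block_mat_mult_vec) auto
  then show ?thesis
    using assms by (intro eq_vecI) auto
qed

lemma append_cols_carrier:
  "A \<in> carrier_mat k m \<Longrightarrow> B \<in> carrier_mat k n \<Longrightarrow> append_cols A B \<in> carrier_mat k (m + n)"
  unfolding append_cols_def using four_block_carrier_mat[of A k m "0\<^sub>m 0 n" 0 n B] by simp

lemma scalar_prod_transpose_mult:
  fixes C :: "'a::comm_semiring_0 mat"
  assumes "C \<in> carrier_mat k n" "v \<in> carrier_vec k" "x \<in> carrier_vec n"
  shows "v \<bullet> (C *\<^sub>v x) = (C\<^sup>T *\<^sub>v v) \<bullet> x"
  using transpose_vec_mult_scalar[OF assms(1,3,2)] assms
  by (metis comm_scalar_prod mult_mat_vec_carrier transpose_carrier_mat)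

text \<open>
  The columns of \<open>Y\<close> are adjusted one after the other. The invariant is that \<open>A Y + B\<close> is injective
  on vectors supported on the first \<open>k\<close> coordinates. If \<open>v (A Y + B) = 0\<close> with \<open>v \<noteq> 0\<close>, then
  \<open>a = v A \<noteq> 0\<close>, and adding \<open>a\<close> to column \<open>k\<close> of \<open>Y\<close> makes \<open>v (A Y + B) x\<close> a nonzero multiple
  of \<open>x\<^sub>k\<close>.
\<close>

lemma exists_det_affine_nonzero:
  fixes A B :: "real mat"
  assumes A: "A \<in> carrier_mat n m" and B: "B \<in> carrier_mat n n"
    and ker: "\<And>v. v \<in> carrier_vec n \<Longrightarrow> A\<^sup>T *\<^sub>v v = 0\<^sub>v m \<Longrightarrow> B\<^sup>T *\<^sub>v v = 0\<^sub>v n \<Longrightarrow> v = 0\<^sub>v n"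
  shows "\<exists>Y\<in>carrier_mat m n. Determinant.det (A * Y + B) \<noteq> 0"
proof -
  \<comment> \<open>The first alternative stops the process: a \<open>Y\<close> with nonzero
    determinant is carried along unchanged. At \<open>k = 0\<close> only the zero vector is tested;
    at \<open>k = n\<close> the second alternative says that the kernel is trivial, so the
    determinant is nonzero after all.\<close>
  have "\<exists>Y\<in>carrier_mat m n. Determinant.det (A * Y + B) \<noteq> 0 \<or>
      (\<forall>x\<in>carrier_vec n. (\<forall>i<n. k \<le> i \<longrightarrow> x $ i = 0) \<longrightarrow> (A * Y + B) *\<^sub>v x = 0\<^sub>v n \<longrightarrow> x = 0\<^sub>v n)"
    if "k \<le> n" for k
    using that
  proof (induction k)
    case 0
    show ?case
      by (intro bexI[of _ "0\<^sub>m m n"]) (auto intro!: eq_vecI)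
  next
    case (Suc k)
    then obtain Y where Y: "Y \<in> carrier_mat m n" and
      Y': "Determinant.det (A * Y + B) \<noteq> 0 \<or>
      (\<forall>x\<in>carrier_vec n. (\<forall>i<n. k \<le> i \<longrightarrow> x $ i = 0) \<longrightarrow> (A * Y + B) *\<^sub>v x = 0\<^sub>v n \<longrightarrow> x = 0\<^sub>v n)"
      by auto
    define C where "C = A * Y + B"
    have C: "C \<in> carrier_mat n n"
      using A B Y by (simp add: C_def)
    show ?case
    proof (cases "Determinant.det C = 0")
      case False
      then show ?thesis using Y C_def by auto
    next
      case True
      then have "Determinant.det C\<^sup>T = 0"
        using det_transpose[OF C] by simp
      then obtain v where v: "v \<in> carrier_vec n" "v \<noteq> 0\<^sub>v n" "C\<^sup>T *\<^sub>v v = 0\<^sub>v n"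
        using C by (subst (asm) det_0_iff_vec_prod_zero[of _ n]) auto
      define a where "a = A\<^sup>T *\<^sub>v v"
      have a: "a \<in> carrier_vec m"
        using A v by (simp add: a_def)
      have "a \<noteq> 0\<^sub>v m"
      proof
        assume a0: "a = 0\<^sub>v m"
        have "C\<^sup>T *\<^sub>v v = Y\<^sup>T *\<^sub>v a + B\<^sup>T *\<^sub>v v"
          using A B Y v unfolding C_def a_def
          by (subst transpose_add[of _ n n]) (auto simp: transpose_mult[of _ n m] add_mult_distrib_mat_vec[of _ n n]
             assoc_mult_mat_vec[of _ n m])
        then have "B\<^sup>T *\<^sub>v v = 0\<^sub>v n"
          using v B Y a0 by auto
        then show False
          using ker[OF v(1)] a0 v(2) by (simp add: a_def)
      qed
      then have aa: "a \<bullet> a \<noteq> 0"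
        using scalar_prod_self_eq_0_iff[OF a] by simp
      define W where "W = Matrix.mat m n (\<lambda>(i, j). if j = k then a $ i else 0)"
      have W: "W \<in> carrier_mat m n"
        by (simp add: W_def)
      have Wx: "W *\<^sub>v x = x $ k \<cdot>\<^sub>v a" if x: "x \<in> carrier_vec n" for x
        using x a Suc.prems
        by (intro eq_vecI) (auto simp: W_def scalar_prod_def if_distrib[of "\<lambda>y. y * _"] sum.delta cong: if_cong)
      have split: "(A * (Y + W) + B) *\<^sub>v x = C *\<^sub>v x + x $ k \<cdot>\<^sub>v (A *\<^sub>v a)" if x: "x \<in> carrier_vec n" for x
      proof -
        have "A * (Y + W) + B = C + A * W"
          using A B Y W unfolding C_def by (subst mult_add_distrib_mat[of _ n m _ n]) (auto simp: comm_add_mat[of _ n n] assoc_add_mat[of _ n n])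
        then show ?thesis
          using x A C W a by (simp add: add_mult_distrib_mat_vec[of _ n n] assoc_mult_mat_vec[of _ n m] Wx mult_mat_vec)
      qed
      show ?thesis
      proof (intro bexI[of _ "Y + W"] disjI2 ballI impI)
        show "Y + W \<in> carrier_mat m n"
          using Y W by simp
        fix x assume x: "x \<in> carrier_vec n" and supp: "\<forall>i<n. Suc k \<le> i \<longrightarrow> x $ i = 0"
          and z: "(A * (Y + W) + B) *\<^sub>v x = 0\<^sub>v n"
        have "0 = v \<bullet> (C *\<^sub>v x + x $ k \<cdot>\<^sub>v (A *\<^sub>v a))"
          using z split[OF x] v by simp
        also have "\<dots> = v \<bullet> (C *\<^sub>v x) + x $ k * (v \<bullet> (A *\<^sub>v a))"
          using v C A x a by (subst scalar_prod_add_distrib[of _ n]) auto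
        also have "\<dots> = x $ k * (a \<bullet> a)"
          using v C A x a by (simp add: scalar_prod_transpose_mult[of _ n n] scalar_prod_transpose_mult[of _ n m] a_def[symmetric])
        finally have xk: "x $ k = 0"
          using aa by simp
        moreover have "0 \<cdot>\<^sub>v (A *\<^sub>v a) = 0\<^sub>v n"
          using A by (intro eq_vecI) auto
        ultimately have "C *\<^sub>v x = 0\<^sub>v n"
          using z split[OF x] A C a x by simp
        moreover have "\<forall>i<n. k \<le> i \<longrightarrow> x $ i = 0"
          using supp xk by (metis le_eq_less_or_eq not_less_eq_eq Suc_leI)
        ultimately show "x = 0\<^sub>v n"
          using Y' True x by (auto simp: C_def)
      qed
    qed
  qed
  from this[of n] obtain Y where Y: "Y \<in> carrier_mat m n" and
    "Determinant.det (A * Y + B) \<noteq> 0 \<or> (\<forall>x\<in>carrier_vec n. (A * Y + B) *\<^sub>v x = 0\<^sub>v n \<longrightarrow> x = 0\<^sub>v n)"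
    by auto
  then have "Determinant.det (A * Y + B) \<noteq> 0"
    using A B det_0_iff_vec_prod_zero[of "A * Y + B" n] by auto
  with Y show ?thesis by blast
qed

text \<open>Translates the rank condition on hypersurfaces into nonvanishing of a polynomial. If the
  columns of (A|B) span, a vector annihilated by both transposes is orthogonal to every vector, so
  to itself, and \<open>exists_det_affine_nonzero\<close> applies. Conversely (A|B) maps (Y w, w) to
  (A Y + B) w, so its column space contains that of an invertible matrix.\<close>

lemma full_rank_append_cols_iff:
  fixes A B :: "real mat"
  assumes A: "A \<in> carrier_mat n m" and B: "B \<in> carrier_mat n n"
  shows "vec_space.rank n (append_cols A B) = n \<longleftrightarrow> (\<exists>Y\<in>carrier_mat m n. Determinant.det (A * Y + B) \<noteq> 0)"
proof -
  interpret vec_space "TYPE(real)" n .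
  have AB: "append_cols A B \<in> carrier_mat n (m + n)"
    using A B by (rule append_cols_carrier)
  show ?thesis
    unfolding rank_eq_n_iff[OF AB]
  proof
    assume full: "col_space (append_cols A B) = carrier_vec n"
    show "\<exists>Y\<in>carrier_mat m n. Determinant.det (A * Y + B) \<noteq> 0"
    proof (rule exists_det_affine_nonzero[OF A B])
      fix v assume v: "v \<in> carrier_vec n" and vA: "A\<^sup>T *\<^sub>v v = 0\<^sub>v m" and vB: "B\<^sup>T *\<^sub>v v = 0\<^sub>v n"
      obtain u where u: "u \<in> carrier_vec (m + n)" "append_cols A B *\<^sub>v u = v"
        using full v AB by (auto simp: col_space_eq[OF AB])
      define a b where "a = vec_first u m" and "b = vec_last u n"
      have ab: "a \<in> carrier_vec m" "b \<in> carrier_vec n" "u = a @\<^sub>v b"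
        using u(1) by (auto simp: a_def b_def)
      have "v \<bullet> v = v \<bullet> (A *\<^sub>v a + B *\<^sub>v b)"
        using u(2) append_cols_mult_vec[OF A B ab(1,2)] ab(3) by simp
      also have "\<dots> = (A\<^sup>T *\<^sub>v v) \<bullet> a + (B\<^sup>T *\<^sub>v v) \<bullet> b"
        using v A B ab by (simp add: scalar_prod_add_distrib[of _ n] scalar_prod_transpose_mult[of _ n m] scalar_prod_transpose_mult[of _ n n])
      also have "\<dots> = 0"
        using ab vA vB by simp
      finally show "v = 0\<^sub>v n"
        using scalar_prod_self_eq_0_iff[OF v] by simp
    qed
  next
    assume "\<exists>Y\<in>carrier_mat m n. Determinant.det (A * Y + B) \<noteq> 0"
    then obtain Y where Y: "Y \<in> carrier_mat m n" "Determinant.det (A * Y + B) \<noteq> 0"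
      by blast
    define C where "C = A * Y + B"
    have C: "C \<in> carrier_mat n n" "Determinant.det C \<noteq> 0"
      using A B Y by (auto simp: C_def)
    then have "rank C = n"
      using det_rank_iff by blast
    then have full: "col_space C = carrier_vec n"
      using rank_eq_n_iff[OF C(1)] by simp
    have "z \<in> col_space (append_cols A B)" if z: "z \<in> carrier_vec n" for z
    proof -
      obtain w where w: "w \<in> carrier_vec n" "C *\<^sub>v w = z"
        using full z C by (auto simp: col_space_eq[OF C(1)])
      have "append_cols A B *\<^sub>v ((Y *\<^sub>v w) @\<^sub>v w) = A *\<^sub>v (Y *\<^sub>v w) + B *\<^sub>v w"
        using A B Y w by (intro append_cols_mult_vec) auto
      also have "\<dots> = z"
        using w A B Y by (simp add: C_def add_mult_distrib_mat_vec[of _ n n] assoc_mult_mat_vec[of _ n m])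
      finally show ?thesis
        using z w Y AB by (auto simp: col_space_eq[OF AB] intro!: bexI[of _ "(Y *\<^sub>v w) @\<^sub>v w"])
    qed
    then show "col_space (append_cols A B) = carrier_vec n"
      using AB by (auto simp: col_space_eq[OF AB])
  qed
qed


text \<open>
  The blocks of an arbitrary \<open>Z\<close> with \<open>det (A Z + B) \<noteq> 0\<close> are replaced by admissible ones one at a
  time: the full rank condition for a block is inherited from the determinant being nonzero.
\<close>

lemma exists_stack_rows_det_nonzero:
  fixes A B :: "real mat"
  assumes "list_all2 (\<lambda>m Q. Q \<subseteq> carrier_mat m n \<and> (\<forall>H\<in>det_hypersurfaces m n. \<not> Q \<subseteq> H)) ms Qs"
    and "A \<in> carrier_mat n (sum_list ms)" "B \<in> carrier_mat n n"
    and "\<exists>Z\<in>carrier_mat (sum_list ms) n. Determinant.det (A * Z + B) \<noteq> 0"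
  shows "\<exists>Ys. list_all2 (\<in>) Ys Qs \<and> Determinant.det (A * stack_rows n Ys + B) \<noteq> 0"
  using assms
proof (induction arbitrary: A B rule: list_all2_induct)
  case Nil
  then obtain Z where Z: "Z \<in> carrier_mat 0 n" "Determinant.det (A * Z + B) \<noteq> 0"
    by auto
  then have "Z = stack_rows n []"
    by (intro eq_matI) (auto simp: stack_rows_Nil)
  then show ?case
    using Z by auto
next
  case (Cons m ms Q Qs)
  define p where "p = sum_list ms"
  obtain Z where Z: "Z \<in> carrier_mat (m + p) n" "Determinant.det (A * Z + B) \<noteq> 0"
    using Cons.prems by (auto simp: p_def)
  have A: "A \<in> carrier_mat n (m + p)" and B: "B \<in> carrier_mat n n"
    using Cons.prems by (auto simp: p_def)
  define A1 where "A1 = Matrix.mat n m (\<lambda>(i, j). A $$ (i, j))"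
  define A2 where "A2 = Matrix.mat n p (\<lambda>(i, j). A $$ (i, m + j))"
  define Z1 where "Z1 = Matrix.mat m n (\<lambda>(i, j). Z $$ (i, j))"
  define Z2 where "Z2 = Matrix.mat p n (\<lambda>(i, j). Z $$ (m + i, j))"
  have carr: "A1 \<in> carrier_mat n m" "A2 \<in> carrier_mat n p" "Z1 \<in> carrier_mat m n" "Z2 \<in> carrier_mat p n"
    by (auto simp: A1_def A2_def Z1_def Z2_def)
  have A_eq: "A = four_block_mat A1 A2 (0\<^sub>m 0 m) (0\<^sub>m 0 p)"
    using A by (intro eq_matI) (auto simp: A1_def A2_def)
  have mult: "A * (X1 @\<^sub>r X2) = A1 * X1 + A2 * X2" if "X1 \<in> carrier_mat m n" "X2 \<in> carrier_mat p n" for X1 X2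
  proof -
    have "X1 @\<^sub>r X2 = four_block_mat X1 (0\<^sub>m m 0) X2 (0\<^sub>m p 0)"
      using that by (simp add: append_rows_def)
    then have "A * (X1 @\<^sub>r X2) = four_block_mat (A1 * X1 + A2 * X2) (A1 * 0\<^sub>m m 0 + A2 * 0\<^sub>m p 0)
        (0\<^sub>m 0 m * X1 + 0\<^sub>m 0 p * X2) (0\<^sub>m 0 m * 0\<^sub>m m 0 + 0\<^sub>m 0 p * 0\<^sub>m p 0)"
      using that carr by (subst A_eq) (simp add: mult_four_block_mat[of A1 n m A2 p _ 0 _ _ n _ 0])
    also have "\<dots> = A1 * X1 + A2 * X2"
      using that carr by (intro eq_matI) auto
    finally show ?thesis .
  qed
  have "Z = Z1 @\<^sub>r Z2"
    using Z by (intro eq_matI) (auto simp: append_rows_def Z1_def Z2_def)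
  then have "A * Z + B = A1 * Z1 + (A2 * Z2 + B)"
    using mult carr B by (simp add: assoc_add_mat[of _ n n])
  \<comment> \<open>\<open>Z1\<close> witnesses that this determinant does not vanish identically in
    the first block, the tail \<open>A2 * Z2\<close> being absorbed into the constant term. So the
    hypersurface for this block is admissible and \<open>Q\<close> has a point off it.\<close>
  then have "vec_space.rank n (append_cols A1 (A2 * Z2 + B)) = n"
    using Z carr B by (subst full_rank_append_cols_iff[of _ _ m]) auto
  then have "det_hypersurface m n A1 (A2 * Z2 + B) \<in> det_hypersurfaces m n"
    unfolding det_hypersurfaces_def
    by (intro CollectI exI[of _ A1] exI[of _ "A2 * Z2 + B"]) (use carr B in simp)
  then have "\<not> Q \<subseteq> det_hypersurface m n A1 (A2 * Z2 + B)" "Q \<subseteq> carrier_mat m n"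
    using Cons.hyps(1) by blast+
  then obtain Y where Y: "Y \<in> Q" "Y \<in> carrier_mat m n" "Determinant.det (A1 * Y + (A2 * Z2 + B)) \<noteq> 0"
    unfolding det_hypersurface_def by blast
  \<comment> \<open>The same determinant regrouped: \<open>Z2\<close> now witnesses nonvanishing for
    the remaining blocks with constant term \<open>A1 * Y + B\<close>. Since the constant term
    changes, the induction runs over all \<open>A\<close> and \<open>B\<close>.\<close>
  then have "Determinant.det (A2 * Z2 + (A1 * Y + B)) \<noteq> 0"
    using carr B comm_add_mat[of "A1 * Y" n n "A2 * Z2"]
    by (simp add: assoc_add_mat[of _ n n, symmetric])
  then obtain Ys where Ys: "list_all2 (\<in>) Ys Qs" "Determinant.det (A2 * stack_rows n Ys + (A1 * Y + B)) \<noteq> 0"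
    using Cons.IH[of A2 "A1 * Y + B"] carr Y B unfolding p_def by auto
  have "list_all2 (\<lambda>m Y. Y \<in> carrier_mat m n) ms Ys"
    using Cons.hyps(2) Ys(1) unfolding list_all2_conv_all_nth by (metis subsetD)
  then have st: "stack_rows n Ys \<in> carrier_mat p n"
    unfolding p_def by (rule stack_rows_carrier)
  have "A * stack_rows n (Y # Ys) + B = A2 * stack_rows n Ys + (A1 * Y + B)"
    using carr B Y st mult[OF Y(2) st] comm_add_mat[of "A1 * Y" n n "A2 * stack_rows n Ys"]
    by (simp add: stack_rows_Cons assoc_add_mat[of _ n n])
  then show ?case
    using Ys Y(1) by (intro exI[of _ "Y # Ys"]) auto
qed

section \<open>Euclidean products of metric and Radon measure spaces\<close>

lemma continuous_map_mdist_component: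
  assumes "finite I" "i \<in> I"
  shows "continuous_map (mtopology_of (l2_metric I X)) (mtopology_of (X i)) (\<lambda>x. x i)"
proof (rule Lipschitz_continuous_imp_continuous_map)
  have "mdist (X i) (x i) (y i) \<le> mdist (l2_metric I X) x y" for x y
    using member_le_L2_set[of I i "\<lambda>i. mdist (X i) (x i) (y i)"] assms by (simp add: mdist_l2_metric)
  then show "Lipschitz_continuous_map (l2_metric I X) (X i) (\<lambda>x. x i)"
    using assms by (auto simp: Lipschitz_continuous_map_def mspace_l2_metric intro!: exI[of _ 1])
qed

text \<open>Links the metric to the product topology of the function type, in terms of which Borel
  sets are defined. Distances from a fixed point are continuous for the product topology, so metric
  balls are open there; conversely every coordinate is continuous for the metric, those outside
  \<open>I\<close> because they are constantly \<open>undefined\<close>.\<close>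

lemma mtopology_of_l2_metric:
  fixes X :: "'i \<Rightarrow> 'a::topological_space metric"
  assumes fin: "finite I" and top: "\<And>i. i \<in> I \<Longrightarrow> mtopology_of (X i) = top_of_set (mspace (X i))"
  shows "mtopology_of (l2_metric I X) = top_of_set (PiE I (\<lambda>i. mspace (X i)))"
proof (rule topology_eq[THEN iffD2], intro allI iffI)
  let ?P = "l2_metric I X" and ?S = "PiE I (\<lambda>i. mspace (X i))"
  interpret P: Metric_space ?S "\<lambda>x y. L2_set (\<lambda>i. mdist (X i) (x i) (y i)) I"
    by (rule Metric_space_l2[OF fin])
  fix W
  {
    assume W: "openin (mtopology_of ?P) W"
    then have W': "openin P.mtopology W"
      by (simp add: l2_metric_def)
    have cont: "continuous_on ?S (\<lambda>y. L2_set (\<lambda>i. mdist (X i) (x i) (y i)) I)" if "x \<in> ?S" for x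
      unfolding L2_set_def
    proof (intro continuous_intros)
      fix i assume i: "i \<in> I"
      have "continuous_map (mtopology_of (X i)) euclidean (mdist (X i) (x i))"
        using that i by (intro continuous_map_mdist) auto
      then have "continuous_on (mspace (X i)) (mdist (X i) (x i))"
        by (simp add: top[OF i])
      moreover have "continuous_on ?S (\<lambda>y. y i)"
        by (rule continuous_on_subset[OF continuous_on_product_coordinates]) simp
      ultimately show "continuous_on ?S (\<lambda>y. mdist (X i) (x i) (y i))"
        by (rule continuous_on_compose2) (use i in auto)
    qed
    show "openin (top_of_set ?S) W"
    proof (subst openin_subopen, intro ballI)
      fix x assume x: "x \<in> W"
      then obtain r where r: "r > 0" "P.mball x r \<subseteq> W"
        using W' P.openin_mtopology by blast
      have xS: "x \<in> ?S"
        using x W' P.openin_mtopology by blast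
      have "openin (top_of_set ?S) (?S \<inter> (\<lambda>y. L2_set (\<lambda>i. mdist (X i) (x i) (y i)) I) -` {..<r})"
        by (rule continuous_openin_preimage_gen) (use cont[OF xS] in auto)
      moreover have "?S \<inter> (\<lambda>y. L2_set (\<lambda>i. mdist (X i) (x i) (y i)) I) -` {..<r} = P.mball x r"
        using xS by auto
      ultimately show "\<exists>T. openin (top_of_set ?S) T \<and> x \<in> T \<and> T \<subseteq> W"
        using r xS by (auto intro!: exI[of _ "P.mball x r"])
    qed
  next
    assume "openin (top_of_set ?S) W"
    then obtain T where T: "open T" "W = ?S \<inter> T"
      by (auto simp: openin_open)
    have "continuous_map (mtopology_of ?P) euclidean (\<lambda>x. x i)" for i
    proof (cases "i \<in> I")
      case True
      then show ?thesis
        using continuous_map_mdist_component[OF fin True, of X] top[OF True]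
        by (simp add: continuous_map_in_subtopology)
    next
      case False
      have "continuous_map (mtopology_of ?P) euclidean (\<lambda>x. undefined)"
        by simp
      then show ?thesis
        by (rule continuous_map_eq) (use False fin in \<open>auto simp: mspace_l2_metric PiE_def extensional_def\<close>)
    qed
    then have "continuous_map (mtopology_of ?P) euclidean (\<lambda>x. x)"
      unfolding euclidean_product_topology[symmetric] continuous_map_componentwise_UNIV by simp
    from openin_continuous_map_preimage[OF this, of T] T
    show "openin (mtopology_of ?P) W"
      using fin by (simp add: mspace_l2_metric Int_def)
  }
qed

lemma mtopology_of_euclid: "mtopology_of (euclid d) = top_of_set (mspace (euclid d))"
  by (simp add: euclid_def mtopology_of_l2_metric mspace_l2_metric)

section \<open>Borel sets, sigma-finiteness and inner regularity\<close>

lemma euclid_borel: "mspace (euclid d) \<in> sets borel"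
proof -
  have "closed (\<Inter>i\<in>{d..}. {x :: nat \<Rightarrow> real. x i = undefined})"
    by (intro closed_INT ballI closed_Collect_eq continuous_on_product_coordinates continuous_on_const)
  moreover have "mspace (euclid d) = (\<Inter>i\<in>{d..}. {x :: nat \<Rightarrow> real. x i = undefined})"
    by (auto simp: mspace_euclid PiE_def extensional_def)
  ultimately show ?thesis
    by (simp add: borel_closed)
qed

lemma sigma_sets_openin:
  fixes U :: "'a::topological_space set"
  shows "sigma_sets U {W. openin (top_of_set U) W} = sets (restrict_space borel U)"
proof -
  have "{(\<lambda>x. x) -` A \<inter> U | A. A \<in> sigma_sets UNIV {S :: 'a set. open S}} =
      sigma_sets U {(\<lambda>x. x) -` A \<inter> U | A. A \<in> {S. open S}}"
    by (rule sigma_sets_vimage_commute) simp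
  moreover have "{(\<lambda>x. x) -` A \<inter> U | A. A \<in> {S. open S}} = {W. openin (top_of_set U) W}"
    by (auto simp: openin_open)
  moreover have "sets (restrict_space borel U) = {(\<lambda>x. x) -` A \<inter> U | A. A \<in> sets (borel :: 'a measure)}"
    by (auto simp: sets_restrict_space)
  moreover have "sets (borel :: 'a measure) = sigma_sets UNIV {S. open S}"
    by (simp add: borel_def)
  ultimately show ?thesis
    by (simp only:)
qed

text \<open>By the Lindelof property, countably many of the open sets of finite measure already
  cover \<open>U\<close>.\<close>

lemma sigma_finite_locally_finite:
  fixes N :: "'a::second_countable_topology measure"
  assumes sets: "sets N = sets (restrict_space borel U)"
    and fin: "\<And>x. x \<in> U \<Longrightarrow> \<exists>W. openin (top_of_set U) W \<and> x \<in> W \<and> emeasure N W < \<infinity>"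
  shows "sigma_finite_measure N"
proof
  have space: "space N = U"
    using sets_eq_imp_space_eq[OF sets] by (simp add: space_restrict_space)
  define \<F> where "\<F> = {T :: 'a set. open T \<and> emeasure N (U \<inter> T) < \<infinity>}"
  obtain \<F>' where F': "\<F>' \<subseteq> \<F>" "countable \<F>'" "\<Union>\<F>' = \<Union>\<F>"
    using Lindelof[of \<F>] by (auto simp: \<F>_def)
  have "U \<subseteq> \<Union>\<F>"
  proof
    fix x assume "x \<in> U"
    from fin[OF this] show "x \<in> \<Union>\<F>"
      by (auto simp: \<F>_def openin_open)
  qed
  then have "\<Union>((\<inter>) U ` \<F>') = space N"
    using F' space by auto
  moreover have "(\<inter>) U ` \<F>' \<subseteq> sets N"
  proof
    fix a assume "a \<in> (\<inter>) U ` \<F>'"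
    then obtain T where "a = U \<inter> T" "open T"
      using F'(1) unfolding \<F>_def by blast
    then show "a \<in> sets N"
      unfolding sets sets_restrict_space by (intro image_eqI[of _ _ T]) auto
  qed
  moreover have "\<forall>a\<in>(\<inter>) U ` \<F>'. emeasure N a \<noteq> \<infinity>"
  proof
    fix a assume "a \<in> (\<inter>) U ` \<F>'"
    then obtain T where "a = U \<inter> T" "T \<in> \<F>"
      using F'(1) by blast
    then show "emeasure N a \<noteq> \<infinity>"
      unfolding \<F>_def by auto
  qed
  ultimately show "\<exists>A. countable A \<and> A \<subseteq> sets N \<and> \<Union>A = space N \<and> (\<forall>a\<in>A. emeasure N a \<noteq> \<infinity>)"
    using F'(2) by blast
qed

text \<open>\<open>inner_regular\<close> concerns finite Borel measures on a whole Polish space. So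
  \<open>N\<close> is cut down to sets \<open>A n\<close> of finite measure exhausting
  \<open>U\<close>, each piece is pushed forward to the type, and continuity from below removes the
  cut.\<close>

lemma inner_regular_sigma_finite:
  fixes N :: "'a::polish_space measure"
  assumes "sigma_finite_measure N" and sets: "sets N = sets (restrict_space borel U)" and U: "U \<in> sets borel"
    and S: "S \<in> sets N"
  shows "emeasure N S = (SUP K \<in> {K. compact K \<and> K \<subseteq> S}. emeasure N K)"
proof (rule antisym)
  interpret sigma_finite_measure N by fact
  have space: "space N = U"
    using sets_eq_imp_space_eq[OF sets] by (simp add: space_restrict_space)
  have sub: "sets N \<subseteq> sets borel"
    using U by (auto simp: sets sets_restrict_space)
  have id: "(\<lambda>x. x) \<in> measurable N borel"
    by (rule measurableI) (auto simp: sets sets_restrict_space space)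
  obtain A :: "nat \<Rightarrow> 'a set" where A: "range A \<subseteq> sets N" "(\<Union>n. A n) = space N"
    "\<And>n. emeasure N (A n) \<noteq> \<infinity>" "incseq A"
    using sigma_finite_incseq by metis
  have "emeasure N (S \<inter> A n) \<le> (SUP K \<in> {K. compact K \<and> K \<subseteq> S}. emeasure N K)" for n
  proof -
    have An: "A n \<in> sets N"
      using A(1) by auto
    define Q where "Q = distr (density N (indicator (A n))) borel (\<lambda>x. x)"
    have Q: "emeasure Q B = emeasure N (A n \<inter> (B \<inter> U))" if "B \<in> sets borel" for B
    proof -
      have "B \<inter> U \<in> sets N"
        using that by (auto simp: sets sets_restrict_space)
      then show ?thesis
        unfolding Q_def using that id An
        by (subst emeasure_distr) (auto simp: space emeasure_restricted)
    qed
    have "emeasure Q (space Q) \<noteq> \<infinity>"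
    proof -
      have "emeasure Q UNIV = emeasure N (A n)"
        using sets.sets_into_space[OF An] by (subst Q) (auto simp: space Int_absorb2)
      then show ?thesis
        using A(3)[of n] by (simp add: Q_def)
    qed
    then have "emeasure Q (S \<inter> A n) = (SUP K \<in> {K. K \<subseteq> S \<inter> A n \<and> compact K}. emeasure Q K)"
      using S An sub by (intro inner_regular) (auto simp: Q_def)
    also have "\<dots> \<le> (SUP K \<in> {K. compact K \<and> K \<subseteq> S}. emeasure N K)"
    proof (rule SUP_least)
      fix K assume K: "K \<in> {K. K \<subseteq> S \<inter> A n \<and> compact K}"
      then have KU: "K \<subseteq> U"
        using sets.sets_into_space[OF S] space by auto
      have "K \<in> sets borel"
        using K by (auto intro: borel_compact)
      then have "emeasure Q K = emeasure N K"
        using K KU by (subst Q) (auto intro!: arg_cong[of _ _ "emeasure N"])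
      then show "emeasure Q K \<le> (SUP K \<in> {K. compact K \<and> K \<subseteq> S}. emeasure N K)"
        using K by (auto intro!: SUP_upper)
    qed
    finally have *: "emeasure Q (S \<inter> A n) \<le> (SUP K \<in> {K. compact K \<and> K \<subseteq> S}. emeasure N K)" .
    have "A n \<inter> (S \<inter> A n \<inter> U) = S \<inter> A n"
      using sets.sets_into_space[OF S] space by auto
    moreover have "S \<inter> A n \<in> sets borel"
      using S An sub by auto
    ultimately show ?thesis
      using * Q[of "S \<inter> A n"] by simp
  qed
  moreover have "emeasure N S = (SUP n. emeasure N (S \<inter> A n))"
  proof -
    have "(\<Union>n. S \<inter> A n) = S"
      using A(2) sets.sets_into_space[OF S] by auto
    moreover have "range (\<lambda>n. S \<inter> A n) \<subseteq> sets N" "incseq (\<lambda>n. S \<inter> A n)"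
      using S A(1,4) by (auto simp: incseq_def)
    ultimately show ?thesis
      using SUP_emeasure_incseq[of "\<lambda>n. S \<inter> A n" N] by simp
  qed
  ultimately show "emeasure N S \<le> (SUP K \<in> {K. compact K \<and> K \<subseteq> S}. emeasure N K)"
    by (auto intro: SUP_least)
next
  show "(SUP K \<in> {K. compact K \<and> K \<subseteq> S}. emeasure N K) \<le> emeasure N S"
    using S by (auto intro!: SUP_least emeasure_mono)
qed

text \<open>Inner regularity is automatic for a locally finite measure on a Borel subset of a Polish
  space, so for the product only the sigma-algebra and local finiteness remain to be
  checked.\<close>

lemma radon_measure_onI:
  fixes N :: "'a::polish_space measure"
  assumes top: "mtopology_of X = top_of_set (mspace X)" and U: "U \<in> sets borel" "U \<subseteq> mspace X"
    and sets: "sets N = sets (restrict_space borel U)"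
    and fin: "\<And>x. x \<in> U \<Longrightarrow> \<exists>W. openin (top_of_set U) W \<and> x \<in> W \<and> emeasure N W < \<infinity>"
  shows "radon_measure_on X U N"
proof -
  have eq: "subtopology (mtopology_of X) U = top_of_set U"
    using U(2) by (simp add: top subtopology_subtopology Int_absorb1)
  have "{K. compactin (mtopology_of X) K \<and> K \<subseteq> S} = {K. compact K \<and> K \<subseteq> S}" if "S \<in> sets N" for S
    using sets.sets_into_space[OF that] U(2) sets_eq_imp_space_eq[OF sets]
    by (auto simp: top compactin_subtopology space_restrict_space)
  then show ?thesis
    unfolding radon_measure_on_def eq sigma_sets_openin
    using inner_regular_sigma_finite[OF sigma_finite_locally_finite[OF sets fin] sets U(1)] fin sets
      sets_eq_imp_space_eq[OF sets]
    by (auto simp: space_restrict_space)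
qed

lemma radon_measure_onD:
  fixes N :: "'a::topological_space measure"
  assumes top: "mtopology_of X = top_of_set (mspace X)" and U: "U \<subseteq> mspace X"
    and radon: "radon_measure_on X U N"
  shows "space N = U" "sets N = sets (restrict_space borel U)"
    "\<And>x. x \<in> U \<Longrightarrow> \<exists>W. openin (top_of_set U) W \<and> x \<in> W \<and> emeasure N W < \<infinity>"
proof -
  have eq: "subtopology (mtopology_of X) U = top_of_set U"
    using U by (simp add: top subtopology_subtopology Int_absorb1)
  show "space N = U" "sets N = sets (restrict_space borel U)"
    "\<And>x. x \<in> U \<Longrightarrow> \<exists>W. openin (top_of_set U) W \<and> x \<in> W \<and> emeasure N W < \<infinity>"
    using radon unfolding radon_measure_on_def eq sigma_sets_openin by auto
qed

text \<open>The identity is measurable in both directions, coordinate by coordinate. Into the Borel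
  sets of the function space this rests on the countable index type and on second countability; the
  coordinates outside \<open>I\<close> are constant.\<close>

lemma sets_PiM_restrict_borel:
  fixes U :: "'i::countable \<Rightarrow> 'a::second_countable_topology set"
  assumes "\<And>i. i \<in> I \<Longrightarrow> sets (N i) = sets (restrict_space borel (U i))"
  shows "sets (PiM I N) = sets (restrict_space borel (PiE I U))"
proof -
  have space: "space (N i) = U i" if "i \<in> I" for i
    using sets_eq_imp_space_eq[OF assms[OF that]] by (simp add: space_restrict_space)
  have sp: "space (PiM I N) = PiE I U"
    using space by (simp add: space_PiM cong: PiE_cong)
  have id: "(\<lambda>x. x) \<in> borel_measurable (PiM I N)"
  proof (rule measurable_coordinatewise_then_product)
    fix i show "(\<lambda>x. x i) \<in> borel_measurable (PiM I N)"
    proof (cases "i \<in> I")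
      case True
      have "(\<lambda>x. x i) \<in> measurable (PiM I N) (N i)"
        using True by measurable
      moreover have "measurable (PiM I N) (N i) = measurable (PiM I N) (restrict_space borel (U i))"
        using assms[OF True] by (rule measurable_cong_sets[OF refl])
      ultimately show ?thesis
        by (simp add: measurable_restrict_space2_iff)
    next
      case False
      have "(\<lambda>x. undefined) \<in> borel_measurable (PiM I N)"
        by simp
      then show ?thesis
        by (rule measurable_cong[THEN iffD1, rotated]) (use False in \<open>auto simp: space_PiM\<close>)
    qed
  qed
  have "A \<in> sets (PiM I N)" if A: "A \<in> sets (restrict_space borel (PiE I U))" for A
  proof -
    obtain B where "A = PiE I U \<inter> B" "B \<in> sets borel"
      using A by (auto simp: sets_restrict_space)
    then show ?thesis
      using measurable_sets[OF id, of B] sp by (simp add: Int_commute)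
  qed
  moreover have "A \<in> sets (restrict_space borel (PiE I U))" if "A \<in> sets (PiM I N)" for A
  proof -
    have "(\<lambda>x. x) \<in> measurable (restrict_space borel (PiE I U)) (PiM I N)"
    proof (rule measurable_PiM_single')
      fix i assume i: "i \<in> I"
      have "(\<lambda>x. x i) \<in> measurable (restrict_space borel (PiE I U)) (restrict_space borel (U i))"
        using i by (intro measurable_restrict_space3) auto
      then show "(\<lambda>x. x i) \<in> measurable (restrict_space borel (PiE I U)) (N i)"
        using measurable_cong_sets[OF refl assms[OF i]] by blast
    qed (use space in \<open>auto simp: space_restrict_space\<close>)
    from measurable_sets[OF this that] show ?thesis
      using sets.sets_into_space[OF that] sp by (simp add: space_restrict_space Int_absorb2)
  qed
  ultimately show ?thesis
    by blast
qed

lemma openin_mball_of: "openin (mtopology_of X) (mball_of X x r)"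
  unfolding mtopology_of_def mball_of_def by (rule Metric_space.openin_mball) simp

lemma mball_of_mono: "r \<le> s \<Longrightarrow> mball_of X x r \<subseteq> mball_of X x s"
  by auto

lemma openin_Int_sets:
  assumes top: "mtopology_of X = top_of_set (mspace X)" and U: "U \<subseteq> mspace X"
    and sets: "sets N = sets (restrict_space borel U)" and W: "openin (mtopology_of X) W"
  shows "W \<inter> U \<in> sets N"
proof -
  obtain T where "open T" "W = mspace X \<inter> T"
    using W by (auto simp: top openin_open)
  then have "W \<inter> U = U \<inter> T" "T \<in> sets borel"
    using U by auto
  then show ?thesis
    unfolding sets sets_restrict_space by (intro image_eqI[of _ _ T]) auto
qed

text \<open>\<open>PiE\<close> also pins the coordinates outside \<open>I\<close> to
  \<open>undefined\<close>, a closed condition, so the set is a countable intersection of coordinate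
  preimages.\<close>

lemma PiE_borel:
  fixes A :: "'i::countable \<Rightarrow> 'a::{second_countable_topology, t1_space} set"
  assumes "\<And>i. i \<in> I \<Longrightarrow> A i \<in> sets borel"
  shows "PiE I A \<in> sets borel"
proof -
  have "(\<lambda>x :: 'i \<Rightarrow> 'a. x i) -` B \<in> sets borel" if "B \<in> sets borel" for i B
    using measurable_sets[of "\<lambda>x :: 'i \<Rightarrow> 'a. x i" borel borel B] that
    by (simp add: borel_measurable_continuous_onI continuous_on_product_coordinates)
  moreover have "{undefined :: 'a} \<in> sets borel"
    by (simp add: borel_closed)
  ultimately have "(\<Inter>i. (\<lambda>x :: 'i \<Rightarrow> 'a. x i) -` (if i \<in> I then A i else {undefined})) \<in> sets borel"
    using assms by (intro sets.countable_INT'') auto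
  moreover have "(\<Inter>i. (\<lambda>x :: 'i \<Rightarrow> 'a. x i) -` (if i \<in> I then A i else {undefined})) = PiE I A"
    by (auto simp: PiE_def Pi_def extensional_def split: if_splits)
  ultimately show ?thesis
    by simp
qed

section \<open>Finite products of Radon measure spaces\<close>

locale radon_product =
  fixes l :: nat and X :: "nat \<Rightarrow> 'a::polish_space metric" and U :: "nat \<Rightarrow> 'a set" and \<mu> :: "nat \<Rightarrow> 'a measure"
  assumes top: "i < l \<Longrightarrow> mtopology_of (X i) = top_of_set (mspace (X i))"
    and borel_mspace: "i < l \<Longrightarrow> mspace (X i) \<in> sets borel"
    and open_U: "i < l \<Longrightarrow> openin (mtopology_of (X i)) (U i)"
    and radon: "i < l \<Longrightarrow> radon_measure_on (X i) (U i) (\<mu> i)"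
begin

text \<open>The locale allows any metrics inducing the topology of a Polish type; for
  \<open>X i = euclid (d i)\<close> this is \<open>euclid_prod l d\<close> by definition.\<close>

abbreviation "P \<equiv> l2_metric {..<l} X"
abbreviation "M \<equiv> PiM {..<l} \<mu>"
abbreviation "B i \<equiv> mball_of (X i)"

lemma mspace_P: "mspace P = PiE {..<l} (\<lambda>i. mspace (X i))"
  by (simp add: mspace_l2_metric)

lemma top_P: "mtopology_of P = top_of_set (mspace P)"
  unfolding mspace_P by (rule mtopology_of_l2_metric) (simp_all add: top)

lemma U_subset: "i < l \<Longrightarrow> U i \<subseteq> mspace (X i)"
  using openin_subset[OF open_U] by simp

lemma U_borel: "i < l \<Longrightarrow> U i \<in> sets borel"
  using open_U[of i] borel_mspace[of i] by (auto simp: top openin_open)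

lemmas space_mu = radon_measure_onD(1)[OF top U_subset radon]
lemmas sets_mu = radon_measure_onD(2)[OF top U_subset radon]
lemmas locally_finite = radon_measure_onD(3)[OF top U_subset radon]

text \<open>\<^locale>\<open>product_sigma_finite\<close> asks for \<open>\<sigma>\<close>-finiteness at all indices, also beyond \<open>l\<close>.\<close>

definition \<nu> :: "nat \<Rightarrow> 'a measure" where
  "\<nu> i = (if i < l then \<mu> i else count_space {})"

sublocale product_sigma_finite \<nu>
proof
  fix i
  have "sigma_finite_measure (\<nu> i)"
  proof (cases "i < l")
    case True
    then show ?thesis
      using sigma_finite_locally_finite[OF sets_mu locally_finite, OF True True] by (simp add: \<nu>_def)
  qed (simp add: \<nu>_def sigma_finite_measure_count_space_finite)
  then show "\<exists>A. countable A \<and> A \<subseteq> sets (\<nu> i) \<and> \<Union>A = space (\<nu> i) \<and> (\<forall>a\<in>A. emeasure (\<nu> i) a \<noteq> \<infinity>)"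
    by (rule sigma_finite_measure.sigma_finite_countable)
qed

lemma M_eq: "M = PiM {..<l} \<nu>"
  by (rule PiM_cong) (auto simp: \<nu>_def)

lemma emeasure_M:
  assumes "\<And>i. i < l \<Longrightarrow> A i \<in> sets (\<mu> i)"
  shows "emeasure M (PiE {..<l} A) = (\<Prod>i<l. emeasure (\<mu> i) (A i))"
proof -
  have "emeasure (PiM {..<l} \<nu>) (PiE {..<l} A) = (\<Prod>i<l. emeasure (\<nu> i) (A i))"
    by (rule emeasure_PiM) (use assms in \<open>auto simp: \<nu>_def\<close>)
  then show ?thesis
    unfolding M_eq by (simp add: \<nu>_def)
qed

lemma space_M: "space M = PiE {..<l} U"
  unfolding space_PiM by (rule PiE_cong) (simp add: space_mu)

lemma PiE_U_subset: "PiE {..<l} U \<subseteq> mspace P"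
  unfolding mspace_P using U_subset by (intro PiE_mono) auto

lemma sets_M: "sets M = sets (restrict_space borel (PiE {..<l} U))"
  by (rule sets_PiM_restrict_borel) (simp add: sets_mu)

lemma sets_muI: "i < l \<Longrightarrow> openin (mtopology_of (X i)) W \<Longrightarrow> W \<inter> U i \<in> sets (\<mu> i)"
  by (rule openin_Int_sets[OF top U_subset sets_mu])

lemma sets_MI: "openin (mtopology_of P) W \<Longrightarrow> W \<inter> PiE {..<l} U \<in> sets M"
  by (rule openin_Int_sets[OF top_P PiE_U_subset sets_M])

lemma openin_PiE:
  assumes "\<And>i. i < l \<Longrightarrow> openin (mtopology_of (X i)) (W i)"
  shows "openin (mtopology_of P) (PiE {..<l} W)"
proof -
  have W: "W i \<subseteq> mspace (X i)" if "i < l" for i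
    using openin_subset[OF assms[OF that]] by simp
  have "openin (mtopology_of P) ((\<Inter>i<l. {x \<in> topspace (mtopology_of P). x i \<in> W i}) \<inter> topspace (mtopology_of P))"
    using assms by (intro openin_INT openin_continuous_map_preimage[OF continuous_map_mdist_component]) auto
  also have "(\<Inter>i<l. {x \<in> topspace (mtopology_of P). x i \<in> W i}) \<inter> topspace (mtopology_of P) = PiE {..<l} W"
    using W by (auto simp: mspace_P PiE_iff subset_eq)
  finally show ?thesis .
qed

text \<open>A null set of factor \<open>i\<close> is pulled back to a cylinder whose measure is a
  product with a zero factor. It vanishes even if other factors have infinite mass, since zero times
  infinity is zero in \<open>ennreal\<close>.\<close>

lemma AE_PiM_all:
  assumes "\<And>i. i < l \<Longrightarrow> AE x in \<mu> i. Q i x"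
  shows "AE x in M. \<forall>i<l. Q i (x i)"
proof -
  have "AE x in M. Q i (x i)" if i: "i < l" for i
  proof -
    obtain N where N: "{x \<in> space (\<mu> i). \<not> Q i x} \<subseteq> N" "N \<in> sets (\<mu> i)" "emeasure (\<mu> i) N = 0"
      using AE_E[OF assms[OF i]] by blast
    let ?A = "\<lambda>j. if j = i then N else space (\<mu> j)"
    have A: "?A j \<in> sets (\<mu> j)" if "j < l" for j
      using N by simp
    have "emeasure M (PiE {..<l} ?A) = (\<Prod>j<l. emeasure (\<mu> j) (?A j))"
      by (rule emeasure_M) (rule A)
    also have "\<dots> = 0"
      using i N(3) by (intro prod_zero) auto
    finally have "emeasure M (PiE {..<l} ?A) = 0" .
    moreover have "PiE {..<l} ?A \<in> sets M"
      using A by (intro sets_PiM_I_finite) auto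
    ultimately have "PiE {..<l} ?A \<in> null_sets M"
      by (simp add: null_sets_def)
    then show ?thesis
    proof (rule AE_I')
      show "{x \<in> space M. \<not> Q i (x i)} \<subseteq> PiE {..<l} ?A"
        using N(1) i by (auto simp: space_PiM PiE_iff subset_eq)
    qed
  qed
  then have "AE x in M. \<forall>i\<in>{..<l}. Q i (x i)"
    by (intro AE_finite_allI) auto
  then show ?thesis
    by (rule eventually_mono) auto
qed

lemma radon_M: "radon_measure_on P (PiE {..<l} U) M"
proof (rule radon_measure_onI[OF top_P _ PiE_U_subset sets_M])
  show "PiE {..<l} U \<in> sets borel"
    using U_borel by (intro PiE_borel) auto
  fix x assume x: "x \<in> PiE {..<l} U"
  have "\<exists>W. openin (mtopology_of (X i)) W \<and> x i \<in> W \<and> W \<subseteq> U i \<and> emeasure (\<mu> i) W < \<infinity>" if i: "i < l" for i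
  proof -
    obtain W where W: "openin (top_of_set (U i)) W" "x i \<in> W" "emeasure (\<mu> i) W < \<infinity>"
      using locally_finite[OF i i i, of "x i"] x i by auto
    have "top_of_set (U i) = subtopology (mtopology_of (X i)) (U i)"
      using U_subset[OF i] by (simp add: top[OF i] subtopology_subtopology Int_absorb1)
    then have "openin (mtopology_of (X i)) W" "W \<subseteq> U i"
      using W(1) open_U[OF i] by (auto simp: openin_open_subtopology)
    then show ?thesis
      using W by blast
  qed
  then obtain W where W: "\<And>i. i < l \<Longrightarrow> openin (mtopology_of (X i)) (W i) \<and> x i \<in> W i \<and> W i \<subseteq> U i \<and> emeasure (\<mu> i) (W i) < \<infinity>"
    by metis
  have "PiE {..<l} W \<subseteq> PiE {..<l} U"
    using W by (intro PiE_mono) auto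
  moreover have "openin (mtopology_of P) (PiE {..<l} W)"
    using W by (intro openin_PiE) auto
  moreover have "top_of_set (PiE {..<l} U) = subtopology (mtopology_of P) (PiE {..<l} U)"
    using PiE_U_subset by (simp add: top_P subtopology_subtopology Int_absorb1)
  moreover have "openin (mtopology_of P) (PiE {..<l} U)"
    using open_U by (rule openin_PiE)
  ultimately have "openin (top_of_set (PiE {..<l} U)) (PiE {..<l} W)"
    by (simp add: openin_open_subtopology)
  moreover have "W i \<in> sets (\<mu> i)" if "i < l" for i
    using sets_muI[OF that, of "W i"] W[OF that] by (simp add: Int_absorb2)
  then have "emeasure M (PiE {..<l} W) = (\<Prod>i<l. emeasure (\<mu> i) (W i))"
    by (rule emeasure_M)
  then have "emeasure M (PiE {..<l} W) < \<infinity>"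
    using W by (simp add: less_top[symmetric] ennreal_prod_eq_top)
  moreover have "x \<in> PiE {..<l} W"
    using x W by (auto simp: PiE_iff)
  ultimately show "\<exists>W. openin (top_of_set (PiE {..<l} U)) W \<and> x \<in> W \<and> emeasure M W < \<infinity>"
    by blast
qed

section \<open>Balls, boxes and the support of the product\<close>

lemma mball_P_subset: "mball_of P x r \<subseteq> PiE {..<l} (\<lambda>i. B i (x i) r)"
proof
  fix y assume y: "y \<in> mball_of P x r"
  then have L: "L2_set (\<lambda>i. mdist (X i) (x i) (y i)) {..<l} < r"
    by (simp add: mdist_l2_metric)
  have "mdist (X i) (x i) (y i) < r" if "i < l" for i
    using member_le_L2_set[of "{..<l}" i "\<lambda>i. mdist (X i) (x i) (y i)"] that L by simp
  then show "y \<in> PiE {..<l} (\<lambda>i. B i (x i) r)"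
    using y by (auto simp: mspace_P PiE_iff)
qed

text \<open>The Euclidean norm is at most the sum of the coordinate distances, and \<open>l\<close>
  times \<open>r / 3 ^ l\<close> is at most \<open>r\<close>. With a power of 3 the Federer
  inequality, which triples radii, can climb from this box to the large one.\<close>

lemma box_subset_mball_P:
  assumes x: "x \<in> mspace P" and r: "r > 0"
  shows "PiE {..<l} (\<lambda>i. B i (x i) (r / 3 ^ l)) \<subseteq> mball_of P x r"
proof
  fix y assume y: "y \<in> PiE {..<l} (\<lambda>i. B i (x i) (r / 3 ^ l))"
  have "L2_set (\<lambda>i. mdist (X i) (x i) (y i)) {..<l} \<le> (\<Sum>i<l. mdist (X i) (x i) (y i))"
    by (rule L2_set_le_sum) simp
  also have "\<dots> < r"
  \<comment> \<open>For \<open>l = 0\<close> the sum is empty and strict monotonicity fails; the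
    bound is then just \<open>0 < r\<close>.\<close>
  proof (cases "l = 0")
    case False
    have "(\<Sum>i<l. mdist (X i) (x i) (y i)) < (\<Sum>i<l. r / 3 ^ l)"
      by (rule sum_strict_mono) (use y False in \<open>auto simp: PiE_iff\<close>)
    also have "\<dots> \<le> r"
    proof -
      have "l < 3 ^ l"
        by (rule less_exp[THEN order.strict_trans2]) (simp add: power_mono)
      then have "real l \<le> 3 ^ l"
        using of_nat_mono[of l "3 ^ l"] by simp
      then show ?thesis
        using r by (simp add: divide_simps mult.commute)
    qed
    finally show ?thesis .
  qed (use r in simp)
  finally show "y \<in> mball_of P x r"
    using x y by (auto simp: mspace_P mdist_l2_metric PiE_iff)
qed

text \<open>Moving only coordinate \<open>i\<close> away from \<open>x\<close> preserves distances,
  so a copy of the factor ball of the same radius sits inside the product ball. Keeping the full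
  radius puts the factor balls used in the Federer and goodness estimates inside
  \<open>W i\<close>.\<close>

lemma mball_subset_of_P:
  assumes x: "x \<in> mspace P" and i: "i < l" and W: "mball_of P x r \<subseteq> PiE {..<l} W"
  shows "B i (x i) r \<subseteq> W i"
proof
  fix y assume y: "y \<in> B i (x i) r"
  have "mdist P x (x(i := y)) = L2_set (\<lambda>j. if j = i then mdist (X i) (x i) y else 0) {..<l}"
    unfolding mdist_l2_metric[OF finite_lessThan]
    by (rule L2_set_cong) (use x in \<open>auto simp: mspace_P PiE_iff mdist_zero\<close>)
  also have "\<dots> = mdist (X i) (x i) y"
    using i by (simp add: L2_set_def if_distrib[of "\<lambda>u. u\<^sup>2"] sum.delta cong: if_cong)
  finally have "x(i := y) \<in> mball_of P x r"
    using x y i by (auto simp: mspace_P PiE_iff extensional_def)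
  then have "x(i := y) \<in> PiE {..<l} W"
    using W by blast
  then show "y \<in> W i"
    using i by (auto simp: PiE_iff dest: bspec[of _ _ i])
qed

lemma sets_ball: "i < l \<Longrightarrow> B i y r \<inter> U i \<in> sets (\<mu> i)"
  by (rule sets_muI[OF _ openin_mball_of])

lemma sets_ball_M: "mball_of P x r \<inter> PiE {..<l} U \<in> sets M"
  by (rule sets_MI[OF openin_mball_of])

lemma sets_box_M: "PiE {..<l} (\<lambda>i. B i (x i) r \<inter> U i) \<in> sets M"
  using sets_ball by (intro sets_PiM_I_finite) auto

lemma emeasure_ball_le:
  "emeasure M (mball_of P x r \<inter> PiE {..<l} U) \<le> (\<Prod>i<l. emeasure (\<mu> i) (B i (x i) r \<inter> U i))"
proof -
  have "emeasure M (mball_of P x r \<inter> PiE {..<l} U) \<le> emeasure M (PiE {..<l} (\<lambda>i. B i (x i) r \<inter> U i))"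
    using mball_P_subset[of x r] by (intro emeasure_mono sets_box_M) (auto simp: PiE_iff)
  then show ?thesis
    by (simp add: emeasure_M sets_ball)
qed

lemma emeasure_ball_ge:
  assumes "x \<in> mspace P" "r > 0"
  shows "(\<Prod>i<l. emeasure (\<mu> i) (B i (x i) (r / 3 ^ l) \<inter> U i)) \<le> emeasure M (mball_of P x r \<inter> PiE {..<l} U)"
proof -
  have "emeasure M (PiE {..<l} (\<lambda>i. B i (x i) (r / 3 ^ l) \<inter> U i)) \<le> emeasure M (mball_of P x r \<inter> PiE {..<l} U)"
    using box_subset_mball_P[OF assms] by (intro emeasure_mono sets_ball_M) (auto simp: PiE_iff)
  then show ?thesis
    by (simp add: emeasure_M sets_ball)
qed

text \<open>Balls around \<open>x\<close> are squeezed between boxes, and a finite product in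
  \<open>ennreal\<close> is positive exactly when every factor is.\<close>

lemma msupport_M: "msupport P M = PiE {..<l} (\<lambda>i. msupport (X i) (\<mu> i))"
proof (intro equalityI subsetI)
  fix x assume x: "x \<in> msupport P M"
  then have xU: "x \<in> PiE {..<l} U"
    by (simp add: msupport_def space_M)
  have "0 < emeasure (\<mu> i) (B i (x i) r \<inter> U i)" if i: "i < l" and r: "r > 0" for i r
  proof -
    have "0 < emeasure M (mball_of P x r \<inter> PiE {..<l} U)"
      using x r by (simp add: msupport_def space_M)
    also have "\<dots> \<le> (\<Prod>i<l. emeasure (\<mu> i) (B i (x i) r \<inter> U i))"
      by (rule emeasure_ball_le)
    finally show ?thesis
      using i by (auto simp: zero_less_iff_neq_zero)
  qed
  then show "x \<in> PiE {..<l} (\<lambda>i. msupport (X i) (\<mu> i))"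
    using xU by (auto simp: msupport_def space_mu PiE_iff)
next
  fix x assume x: "x \<in> PiE {..<l} (\<lambda>i. msupport (X i) (\<mu> i))"
  then have xU: "x \<in> PiE {..<l} U"
    by (auto simp: msupport_def space_mu PiE_iff)
  have "0 < emeasure M (mball_of P x r \<inter> PiE {..<l} U)" if r: "r > 0" for r
  proof -
    have "0 < emeasure (\<mu> i) (B i (x i) (r / 3 ^ l) \<inter> U i)" if "i < l" for i
      using x that r by (auto simp: msupport_def space_mu PiE_iff)
    then have "0 < (\<Prod>i<l. emeasure (\<mu> i) (B i (x i) (r / 3 ^ l) \<inter> U i))"
      by (auto simp: zero_less_iff_neq_zero)
    then show ?thesis
      using emeasure_ball_ge[of x r] xU PiE_U_subset r by (auto intro: order.strict_trans2)
  qed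
  then show "x \<in> msupport P M"
    using xU by (auto simp: msupport_def space_M)
qed

section \<open>Federer constants of products\<close>

lemma federer_iterate:
  assumes i: "i < l" and F: "federer_const_on (X i) (\<mu> i) D W" and W: "W \<subseteq> U i"
    and x: "x \<in> msupport (X i) (\<mu> i)" and r: "r > 0" and sub: "B i x r \<subseteq> W"
  shows "emeasure (\<mu> i) (B i x (3 * r) \<inter> U i) \<le> ennreal D ^ Suc k * emeasure (\<mu> i) (B i x (r / 3 ^ k) \<inter> U i)"
proof -
  \<comment> \<open>Every tripling starts from a radius at most \<open>r\<close>, so the smaller
    ball stays in \<open>W\<close>; only the tripled ball may leave it, which the definition
    permits. Going from \<open>r / 3 ^ k\<close> up to \<open>3 * r\<close> takes
    \<open>k + 1\<close> triplings.\<close>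
  have step: "emeasure (\<mu> i) (B i x (3 * s) \<inter> U i) \<le> ennreal D * emeasure (\<mu> i) (B i x s \<inter> U i)"
    if s: "0 < s" "s \<le> r" for s
  proof -
    have "B i x s \<subseteq> W"
      using mball_of_mono[OF s(2), of "X i" x] sub by blast
    then have "emeasure (\<mu> i) (B i x (3 * s) \<inter> U i) < ennreal D * emeasure (\<mu> i) (B i x s)" "B i x s \<inter> U i = B i x s"
      using F x s(1) W i unfolding federer_const_on_def by (auto simp: space_mu)
    then show ?thesis
      by simp
  qed
  show ?thesis
  proof (induction k)
    case 0
    then show ?case
      using step[of r] r by simp
  next
    case (Suc k)
    have "emeasure (\<mu> i) (B i x (r / 3 ^ k) \<inter> U i) \<le> ennreal D * emeasure (\<mu> i) (B i x (r / 3 ^ Suc k) \<inter> U i)"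
      using step[of "r / 3 ^ Suc k"] r one_le_power[of "3 :: real" "Suc k"]
      by (simp add: divide_le_eq mult_le_cancel_left1)
    then have "ennreal D ^ Suc k * emeasure (\<mu> i) (B i x (r / 3 ^ k) \<inter> U i) \<le>
        ennreal D ^ Suc k * (ennreal D * emeasure (\<mu> i) (B i x (r / 3 ^ Suc k) \<inter> U i))"
      by (rule mult_left_mono) simp
    also have "\<dots> = ennreal D ^ Suc (Suc k) * emeasure (\<mu> i) (B i x (r / 3 ^ Suc k) \<inter> U i)"
      by (simp add: mult_ac)
    finally show ?case
      using Suc.IH by (rule order.trans[rotated])
  qed
qed

text \<open>Taking \<open>k = l\<close> in \<open>federer_iterate\<close> leads from the box of
  radius \<open>3 * r\<close> to the inscribed box of radius \<open>r / 3 ^ l\<close>, whence the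
  exponent \<open>Suc l\<close>. Finiteness comes from the strict inequality in
  \<open>federer_const_on\<close>: what is strictly below something is not infinite.\<close>

lemma federer_box:
  assumes W: "\<And>i. i < l \<Longrightarrow> federer_const_on (X i) (\<mu> i) (D i) (W i) \<and> W i \<subseteq> U i"
    and x: "x \<in> msupport P M" and r: "r > 0" and sub: "mball_of P x r \<subseteq> PiE {..<l} W"
    and D: "\<And>i. i < l \<Longrightarrow> 0 < D i"
  shows "(\<Prod>i<l. emeasure (\<mu> i) (B i (x i) (3 * r) \<inter> U i))
      \<le> ennreal (\<Prod>i<l. D i ^ Suc l) * emeasure M (mball_of P x r \<inter> PiE {..<l} U)"
    and "(\<Prod>i<l. emeasure (\<mu> i) (B i (x i) (3 * r) \<inter> U i)) < \<infinity>"
proof -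
  have xU: "x \<in> mspace P"
    using x PiE_U_subset by (auto simp: msupport_def space_M)
  have xi: "x i \<in> msupport (X i) (\<mu> i)" if "i < l" for i
    using x that by (auto simp: msupport_M PiE_iff)
  have Wi: "B i (x i) r \<subseteq> W i" if "i < l" for i
    by (rule mball_subset_of_P[OF xU that sub])
  have "(\<Prod>i<l. emeasure (\<mu> i) (B i (x i) (3 * r) \<inter> U i))
      \<le> (\<Prod>i<l. ennreal (D i) ^ Suc l * emeasure (\<mu> i) (B i (x i) (r / 3 ^ l) \<inter> U i))"
  proof (rule prod_mono_ennreal)
    fix i assume "i \<in> {..<l}"
    then have i: "i < l"
      by simp
    show "emeasure (\<mu> i) (B i (x i) (3 * r) \<inter> U i)
        \<le> ennreal (D i) ^ Suc l * emeasure (\<mu> i) (B i (x i) (r / 3 ^ l) \<inter> U i)"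
      by (rule federer_iterate[OF i _ _ xi[OF i] r Wi[OF i]]) (use W[OF i] in auto)
  qed
  also have "\<dots> = (\<Prod>i<l. ennreal (D i ^ Suc l)) * (\<Prod>i<l. emeasure (\<mu> i) (B i (x i) (r / 3 ^ l) \<inter> U i))"
    unfolding prod.distrib using D
    by (intro arg_cong2[where f = "(*)"] prod.cong refl ennreal_power less_imp_le) auto
  also have "(\<Prod>i<l. ennreal (D i ^ Suc l)) = ennreal (\<Prod>i<l. D i ^ Suc l)"
    using D by (intro prod_ennreal) (auto intro: less_imp_le simp del: power_Suc)
  also have "ennreal (\<Prod>i<l. D i ^ Suc l) * (\<Prod>i<l. emeasure (\<mu> i) (B i (x i) (r / 3 ^ l) \<inter> U i))
      \<le> ennreal (\<Prod>i<l. D i ^ Suc l) * emeasure M (mball_of P x r \<inter> PiE {..<l} U)"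
    by (intro mult_left_mono emeasure_ball_ge xU r) simp
  finally show "(\<Prod>i<l. emeasure (\<mu> i) (B i (x i) (3 * r) \<inter> U i))
      \<le> ennreal (\<Prod>i<l. D i ^ Suc l) * emeasure M (mball_of P x r \<inter> PiE {..<l} U)" .
  have "emeasure (\<mu> i) (B i (x i) (3 * r) \<inter> U i) < \<infinity>" if "i < l" for i
  proof -
    have "emeasure (\<mu> i) (B i (x i) (3 * r) \<inter> U i) < ennreal (D i) * emeasure (\<mu> i) (B i (x i) r)"
      using W[OF that] xi[OF that] Wi[OF that] r that unfolding federer_const_on_def by (simp add: space_mu)
    also have "\<dots> \<le> \<infinity>"
      by simp
    finally show ?thesis .
  qed
  then show "(\<Prod>i<l. emeasure (\<mu> i) (B i (x i) (3 * r) \<inter> U i)) < \<infinity>"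
    by (simp add: less_top[symmetric] ennreal_prod_eq_top)
qed

text \<open>The extra 1 in the constant restores the strict inequality. This uses that the ball has
  positive measure, its centre being in the support, and finite measure, by the second part of
  \<open>federer_box\<close>.\<close>

lemma federer_const_on_PiE:
  assumes W: "\<And>i. i < l \<Longrightarrow> federer_const_on (X i) (\<mu> i) (D i) (W i) \<and> W i \<subseteq> U i"
    and D: "\<And>i. i < l \<Longrightarrow> 0 < D i"
  shows "federer_const_on P M ((\<Prod>i<l. D i ^ Suc l) + 1) (PiE {..<l} W)"
  unfolding federer_const_on_def
proof (intro ballI allI impI)
  fix x and r :: real assume x: "x \<in> msupport P M" and r: "0 < r" and sub: "mball_of P x r \<subseteq> PiE {..<l} W"
  let ?e = "emeasure M (mball_of P x r)"
  have "PiE {..<l} W \<subseteq> PiE {..<l} U"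
    using W by (intro PiE_mono) auto
  then have eq: "mball_of P x r \<inter> PiE {..<l} U = mball_of P x r"
    using sub by blast
  have pos: "0 < ?e"
    using x r eq unfolding msupport_def space_M by force
  have "?e \<le> emeasure M (mball_of P x (3 * r) \<inter> PiE {..<l} U)"
    using mball_of_mono[of r "3 * r" P x] r eq by (intro emeasure_mono sets_ball_M) auto
  also have "\<dots> \<le> (\<Prod>i<l. emeasure (\<mu> i) (B i (x i) (3 * r) \<inter> U i))"
    by (rule emeasure_ball_le)
  also have "\<dots> < \<infinity>"
    by (rule federer_box(2)[OF W x r sub D])
  finally have fin: "?e < \<infinity>" .
  have "emeasure M (mball_of P x (3 * r) \<inter> PiE {..<l} U) \<le> ennreal (\<Prod>i<l. D i ^ Suc l) * ?e"
    using order.trans[OF emeasure_ball_le federer_box(1)[OF W x r sub D]] eq by simp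
  also have "\<dots> < ennreal (\<Prod>i<l. D i ^ Suc l) * ?e + ?e"
    using pos fin by (simp add: ennreal_mult_less_top ennreal_add_left_cancel_less less_top)
  also have "\<dots> = ennreal ((\<Prod>i<l. D i ^ Suc l) + 1) * ?e"
  proof -
    have "0 \<le> (\<Prod>i<l. D i ^ Suc l)"
      using D by (intro prod_nonneg ballI zero_le_power) (auto intro: less_imp_le)
    then show ?thesis
      by (simp add: ennreal_plus distrib_right del: power_Suc)
  qed
  finally show "emeasure M (mball_of P x (3 * r) \<inter> space M) < ennreal ((\<Prod>i<l. D i ^ Suc l) + 1) * ?e"
    by (simp add: space_M)
qed

end

section \<open>Good functions on products\<close>

lemma threshold_crossing:
  fixes g \<delta> :: "nat \<Rightarrow> real"
  assumes "\<delta> 0 \<le> g 0" "g l < \<delta> l"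
  shows "\<exists>j<l. \<delta> j \<le> g j \<and> g (Suc j) < \<delta> (Suc j)"
  using assms
proof (induction l)
  case (Suc l)
  then show ?case
    by (cases "g l < \<delta> l") (auto intro: less_SucI)
qed simp

lemma ennpowr_ennreal: "0 \<le> t \<Longrightarrow> ennpowr (ennreal t) \<alpha> = ennreal (t powr \<alpha>)"
  by (simp add: ennpowr_def)

lemma ennpowr_mono:
  assumes "a \<le> b" "0 \<le> \<alpha>"
  shows "ennpowr a \<alpha> \<le> ennpowr b \<alpha>"
proof (cases "b = \<infinity>")
  case False
  then have b: "b < \<infinity>"
    by (simp add: less_top)
  then have "enn2real a \<le> enn2real b"
    using assms(1) by (intro enn2real_mono) auto
  moreover have "a \<noteq> \<infinity>"
    using b assms(1) by auto
  ultimately show ?thesis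
    using False assms(2) by (auto simp: ennpowr_def intro!: ennreal_leI powr_mono2)
qed (simp add: ennpowr_def)

lemma ennreal_divide_antimono:
  fixes a b c :: ennreal
  assumes "c \<le> b"
  shows "a / b \<le> a / c"
proof -
  have "inverse b \<le> inverse c"
    using assms including ennreal.lifting by transfer (rule ereal_inverse_antimono)
  then show ?thesis
    unfolding divide_ennreal_def by (intro mult_left_mono) auto
qed

lemma good_on_cong:
  assumes "good_on X N C \<alpha> W f" "\<And>y. y \<in> W \<Longrightarrow> g y = f y"
  shows "good_on X N C \<alpha> W g"
  unfolding good_on_def
proof (intro ballI allI impI)
  fix x and r \<epsilon> :: real
  assume *: "x \<in> msupport X N" "0 < r" "mball_of X x r \<subseteq> W" "0 < \<epsilon>"
  have "{y \<in> mball_of X x r. \<bar>g y\<bar> < \<epsilon>} = {y \<in> mball_of X x r. \<bar>f y\<bar> < \<epsilon>}"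
    using *(3) assms(2) by (metis (no_types, lifting) subsetD)
  moreover have "sup_norm_on X N (mball_of X x r) g = sup_norm_on X N (mball_of X x r) f"
    unfolding sup_norm_on_def using *(3) assms(2) by (intro SUP_cong) auto
  ultimately show "emeasure N {y \<in> mball_of X x r. \<bar>g y\<bar> < \<epsilon>}
      \<le> ennreal C * ennpowr (ennreal \<epsilon> / sup_norm_on X N (mball_of X x r) g) \<alpha> * emeasure N (mball_of X x r)"
    using assms(1) * unfolding good_on_def by simp
qed

lemma good_on_subset: "good_on X N C \<alpha> W f \<Longrightarrow> W' \<subseteq> W \<Longrightarrow> good_on X N C \<alpha> W' f"
  unfolding good_on_def by blast

lemma federer_const_on_subset: "federer_const_on X N D W \<Longrightarrow> W' \<subseteq> W \<Longrightarrow> federer_const_on X N D W'"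
  unfolding federer_const_on_def by blast

text \<open>A single support point with value at least \<open>s\<close> bounds the sup norm from
  below, and the quotient is antitone in that norm, also when the norm is infinite. Slices of a
  function are controlled only through such a point.\<close>

lemma good_onD_point:
  assumes good: "good_on X N C \<alpha> W g" and x: "x \<in> msupport X N" and r: "0 < r" "mball_of X x r \<subseteq> W"
    and p: "p \<in> mball_of X x r" "p \<in> msupport X N" "s \<le> \<bar>g p\<bar>" and s: "0 < s" and \<epsilon>: "0 < \<epsilon>" and \<alpha>: "0 \<le> \<alpha>"
  shows "emeasure N {y \<in> mball_of X x r. \<bar>g y\<bar> < \<epsilon>} \<le> ennreal C * ennreal ((\<epsilon> / s) powr \<alpha>) * emeasure N (mball_of X x r)"
proof -
  have "ennreal s \<le> ennreal \<bar>g p\<bar>"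
    using p(3) by (rule ennreal_leI)
  also have "\<dots> \<le> sup_norm_on X N (mball_of X x r) g"
    unfolding sup_norm_on_def using p by (intro SUP_upper) auto
  finally have "ennreal \<epsilon> / sup_norm_on X N (mball_of X x r) g \<le> ennreal \<epsilon> / ennreal s"
    by (rule ennreal_divide_antimono)
  also have "\<dots> = ennreal (\<epsilon> / s)"
    using \<epsilon> s by (simp add: divide_ennreal)
  finally have "ennpowr (ennreal \<epsilon> / sup_norm_on X N (mball_of X x r) g) \<alpha> \<le> ennreal ((\<epsilon> / s) powr \<alpha>)"
    using ennpowr_mono[OF _ \<alpha>] \<epsilon> s by (metis ennpowr_ennreal divide_nonneg_pos less_imp_le)
  then have "ennreal C * ennpowr (ennreal \<epsilon> / sup_norm_on X N (mball_of X x r) g) \<alpha> * emeasure N (mball_of X x r)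
      \<le> ennreal C * ennreal ((\<epsilon> / s) powr \<alpha>) * emeasure N (mball_of X x r)"
    by (intro mult_right_mono mult_left_mono) auto
  then show ?thesis
    using good x r \<epsilon> unfolding good_on_def by (meson order.trans)
qed

context radon_product
begin

text \<open>Tonelli with \<open>j\<close> as the inner variable: a slice bound whose constant is
  independent of the other coordinates integrates to a bound for the whole set.\<close>

lemma emeasure_le_slices:
  assumes j: "j < l" and E: "E \<in> sets M" "E \<subseteq> PiE {..<l} A" and A: "\<And>i. i < l \<Longrightarrow> A i \<in> sets (\<mu> i)"
    and slice: "\<And>x. x \<in> PiE {..<l} A \<Longrightarrow> emeasure (\<mu> j) {y \<in> A j. x(j := y) \<in> E} \<le> c * emeasure (\<mu> j) (A j)"
  shows "emeasure M E \<le> c * (\<Prod>i<l. emeasure (\<mu> i) (A i))"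
proof -
  define I where "I = {..<l} - {j}"
  have I: "finite I" "j \<notin> I" "insert j I = {..<l}"
    using j by (auto simp: I_def)
  have M': "M = PiM (insert j I) \<nu>"
    using M_eq I(3) by simp
  have E': "E \<in> sets (PiM (insert j I) \<nu>)"
    using E(1) M' by simp
  have Aj: "A j \<subseteq> space (\<mu> j)"
    using sets.sets_into_space[OF A[OF j]] .
  have "emeasure M E = (\<integral>\<^sup>+ x. indicator E x \<partial>PiM (insert j I) \<nu>)"
    using E' by (simp add: M')
  also have "\<dots> = (\<integral>\<^sup>+ x. (\<integral>\<^sup>+ y. indicator E (x(j := y)) \<partial>\<nu> j) \<partial>PiM I \<nu>)"
    using E' by (intro product_nn_integral_insert[OF I(1,2)]) simp
  also have "\<dots> \<le> (\<integral>\<^sup>+ x. c * emeasure (\<mu> j) (A j) * indicator (PiE I A) x \<partial>PiM I \<nu>)"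
  proof (rule nn_integral_mono)
    fix x assume x: "x \<in> space (PiM I \<nu>)"
    have ext: "x \<in> extensional I"
      using x by (auto simp: space_PiM PiE_def)
    let ?S = "{y \<in> A j. x(j := y) \<in> E}"
    have xy: "x(j := y) \<in> PiE {..<l} A \<longleftrightarrow> y \<in> A j \<and> x \<in> PiE I A" for y
      unfolding I(3)[symmetric] using I(2) ext by (auto simp: PiE_iff extensional_def)
    have "(\<lambda>y. x(j := y)) \<in> measurable (\<nu> j) (PiM (insert j I) \<nu>)"
      using x I(2) by (rule measurable_component_update)
    then have "(\<lambda>y. x(j := y)) -` E \<inter> space (\<nu> j) \<in> sets (\<nu> j)"
      using E' by (rule measurable_sets)
    moreover have "(\<lambda>y. x(j := y)) -` E \<inter> space (\<nu> j) = ?S"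
      using E(2) xy Aj j by (auto simp: \<nu>_def)
    ultimately have "?S \<in> sets (\<nu> j)"
      by simp
    then have "(\<integral>\<^sup>+ y. indicator ?S y \<partial>\<nu> j) = emeasure (\<mu> j) ?S"
      using j by (simp add: \<nu>_def)
    moreover have "(\<integral>\<^sup>+ y. indicator E (x(j := y)) \<partial>\<nu> j) = (\<integral>\<^sup>+ y. indicator ?S y \<partial>\<nu> j)"
      using E(2) xy by (intro nn_integral_cong) (auto simp: indicator_def)
    moreover have "emeasure (\<mu> j) ?S \<le> c * emeasure (\<mu> j) (A j) * indicator (PiE I A) x"
    \<comment> \<open>\<open>slice\<close> is available only for points of the full box, so
      \<open>x\<close> has to be completed by some \<open>y0\<close> in \<open>A j\<close>. If there
      is none, or \<open>x\<close> lies outside, the slice is empty.\<close>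
    proof (cases "x \<in> PiE I A \<and> A j \<noteq> {}")
      case True
      then obtain y0 where "y0 \<in> A j"
        by blast
      then show ?thesis
        using slice[of "x(j := y0)"] xy[of y0] True by simp
    next
      case False
      then have "x(j := y) \<notin> PiE {..<l} A" for y
        using xy[of y] by blast
      then have S: "?S = {}"
        using E(2) by blast
      show ?thesis
        unfolding S by simp
    qed
    ultimately show "(\<integral>\<^sup>+ y. indicator E (x(j := y)) \<partial>\<nu> j) \<le> c * emeasure (\<mu> j) (A j) * indicator (PiE I A) x"
      by simp
  qed
  also have "\<dots> = c * emeasure (\<mu> j) (A j) * emeasure (PiM I \<nu>) (PiE I A)"
    using A by (intro nn_integral_cmult_indicator sets_PiM_I_finite) (auto simp: I_def \<nu>_def)
  also have "emeasure (PiM I \<nu>) (PiE I A) = (\<Prod>i\<in>I. emeasure (\<mu> i) (A i))"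
    using A I(1) by (subst emeasure_PiM) (auto simp: I_def \<nu>_def intro!: prod.cong)
  also have "c * emeasure (\<mu> j) (A j) * (\<Prod>i\<in>I. emeasure (\<mu> i) (A i)) = c * (\<Prod>i<l. emeasure (\<mu> i) (A i))"
    unfolding I(3)[symmetric] using I(1,2) by (simp add: mult.assoc)
  finally show ?thesis .
qed

text \<open>
  If \<open>\<bar>f p\<bar> \<ge> s\<close> and \<open>\<bar>f y\<bar> < \<epsilon> = t s\<close>, change the coordinates of \<open>p\<close> into those of \<open>y\<close> one after the
  other. At some step \<open>j\<close> the value of \<open>\<bar>f\<bar>\<close> drops from at least \<open>s t\<^bsup>j/l\<^esup>\<close> to below \<open>s t\<^bsup>(j+1)/l\<^esup>\<close>, and
  goodness in the variable \<open>j\<close> bounds the measure of the set of such \<open>y\<close>.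
\<close>

lemma good_on_box:
  fixes \<alpha> C :: "nat \<Rightarrow> real"
  assumes f: "f \<in> borel_measurable M"
    and W: "\<And>i. i < l \<Longrightarrow> W i \<subseteq> U i"
    and C: "\<And>i. i < l \<Longrightarrow> 0 < C i"
    and \<alpha>: "\<And>i. i < l \<Longrightarrow> real l * \<beta> \<le> \<alpha> i" "0 < \<beta>"
    and good: "\<And>i z. i < l \<Longrightarrow> z \<in> PiE {..<l} W \<Longrightarrow> good_on (X i) (\<mu> i) (C i) (\<alpha> i) (W i) (\<lambda>y. f (z(i := y)))"
    and x: "\<And>i. i < l \<Longrightarrow> x i \<in> msupport (X i) (\<mu> i)" and r: "0 < r"
    and sub: "\<And>i. i < l \<Longrightarrow> B i (x i) r \<subseteq> W i"
    and p: "p \<in> PiE {..<l} (\<lambda>i. B i (x i) r)" "p \<in> msupport P M" "s \<le> \<bar>f p\<bar>"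
    and s: "0 < s" and \<epsilon>: "0 < \<epsilon>"
  shows "emeasure M {y \<in> PiE {..<l} (\<lambda>i. B i (x i) r). \<bar>f y\<bar> < \<epsilon>}
    \<le> ennreal ((1 + (\<Sum>i<l. C i)) * (\<epsilon> / s) powr \<beta>) * (\<Prod>i<l. emeasure (\<mu> i) (B i (x i) r))"
proof -
  define A where "A = (\<lambda>i. B i (x i) r)"
  define Q where "Q = (\<Prod>i<l. emeasure (\<mu> i) (A i))"
  have AW: "A i \<subseteq> W i" if "i < l" for i
    using sub[OF that] by (simp add: A_def)
  have A: "A i \<in> sets (\<mu> i)" if "i < l" for i
  proof -
    have "A i \<inter> U i = A i"
      using AW[OF that] W[OF that] by blast
    then show ?thesis
      using sets_ball[OF that, of "x i" r] by (simp add: A_def)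
  qed
  have box: "PiE {..<l} A \<in> sets M"
    using A by (intro sets_PiM_I_finite) auto
  have C0: "0 \<le> (\<Sum>i<l. C i)"
    using C by (intro sum_nonneg) (auto intro: less_imp_le)
  have pA: "p i \<in> A i" if "i < l" for i
    using PiE_mem[OF p(1), of i] that unfolding A_def by simp
  have p_ext: "p i = undefined" if "\<not> i < l" for i
    using PiE_arb[OF p(1), of i] that by simp
  have p_supp: "p i \<in> msupport (X i) (\<mu> i)" if "i < l" for i
    using PiE_mem[OF p(2)[unfolded msupport_M], of i] that by simp
  have "emeasure M {y \<in> PiE {..<l} A. \<bar>f y\<bar> < \<epsilon>} \<le> ennreal ((1 + (\<Sum>i<l. C i)) * (\<epsilon> / s) powr \<beta>) * Q"
  proof (cases "s \<le> \<epsilon>")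
    case True
    \<comment> \<open>Here the claim is trivial, the set being contained in the box and the factor
      being at least 1; the summand 1 in the constant serves this case.\<close>
    have "1 \<le> (\<epsilon> / s) powr \<beta>"
      using True s \<alpha>(2) by (intro ge_one_powr_ge_zero) (auto simp: divide_simps)
    then have "1 \<le> (1 + (\<Sum>i<l. C i)) * (\<epsilon> / s) powr \<beta>"
      using C0 mult_mono[of 1 "1 + (\<Sum>i<l. C i)" 1 "(\<epsilon> / s) powr \<beta>"] by simp
    then have "1 * Q \<le> ennreal ((1 + (\<Sum>i<l. C i)) * (\<epsilon> / s) powr \<beta>) * Q"
      by (intro mult_right_mono) (auto simp: ennreal_le_iff2 simp flip: ennreal_1)
    moreover have "emeasure M {y \<in> PiE {..<l} A. \<bar>f y\<bar> < \<epsilon>} \<le> emeasure M (PiE {..<l} A)"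
      using box by (intro emeasure_mono) auto
    moreover have "emeasure M (PiE {..<l} A) = Q"
      unfolding Q_def by (rule emeasure_M) (rule A)
    ultimately show ?thesis
      by simp
  next
    case False
    define t where "t = \<epsilon> / s"
    have t: "0 < t" "t < 1"
      using False s \<epsilon> by (auto simp: t_def)
    \<comment> \<open>Geometric thresholds from \<open>s\<close> at \<open>j = 0\<close> down to
      \<epsilon> at \<open>j = l\<close>, with ratio \<open>t powr (1 / l)\<close>. For
      \<open>l = 0\<close> division by zero gives exponent 0, so the threshold is still
      \<open>s\<close>, which exceeds \<epsilon>.\<close>
    define \<delta> where "\<delta> = (\<lambda>j. s * t powr (real j / real l))"
    have \<delta>: "0 < \<delta> j" for j
      using s t by (simp add: \<delta>_def)
    define mix where "mix = (\<lambda>j y. \<lambda>i\<in>{..<l}. if i < j then y i else p i)"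
    have mix_0: "mix 0 y = p" for y
      by (auto simp: mix_def p_ext)
    have mix_l: "mix l y = y" if "y \<in> PiE {..<l} A" for y
      using that by (auto simp: mix_def PiE_def extensional_def)
    have mix_A: "mix j y \<in> PiE {..<l} A" if "y \<in> PiE {..<l} A" for j y
      using that pA by (auto simp: mix_def)
    \<comment> \<open>\<open>mix j\<close> ignores coordinate \<open>j\<close> of \<open>y\<close>,
      while \<open>mix (Suc j)\<close> sees it. On a slice in direction \<open>j\<close> the lower
      bound in \<open>E j\<close> is therefore constant and only the upper bound varies.\<close>
    have mix_upd: "mix j (y(j := u)) = mix j y" for j y u
      by (auto simp: mix_def)
    have mix_Suc_upd: "mix (Suc j) (y(j := u)) = (mix j y)(j := u)" if "j < l" for j y u
      using that by (auto simp: mix_def)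
    have mix_meas: "mix j \<in> measurable M M" for j
    proof -
      have "(\<lambda>y. if i < j then y i else p i) \<in> measurable M (\<mu> i)" if "i < l" for i
        using that pA[OF that] sets.sets_into_space[OF A[OF that]] by auto
      then show ?thesis
        unfolding mix_def by (intro measurable_restrict) auto
    qed
    define E where "E = (\<lambda>j. {y \<in> PiE {..<l} A. \<delta> j \<le> \<bar>f (mix j y)\<bar> \<and> \<bar>f (mix (Suc j) y)\<bar> < \<delta> (Suc j)})"
    have E: "E j \<in> sets M" for j
    proof -
      note [measurable] = measurable_compose[OF mix_meas f]
      have "{y \<in> space M. \<delta> j \<le> \<bar>f (mix j y)\<bar> \<and> \<bar>f (mix (Suc j) y)\<bar> < \<delta> (Suc j)} \<in> sets M"
        by measurable
      then have "PiE {..<l} A \<inter> {y \<in> space M. \<delta> j \<le> \<bar>f (mix j y)\<bar> \<and> \<bar>f (mix (Suc j) y)\<bar> < \<delta> (Suc j)} \<in> sets M"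
        using box by (rule sets.Int[rotated])
      moreover have "PiE {..<l} A \<inter> {y \<in> space M. \<delta> j \<le> \<bar>f (mix j y)\<bar> \<and> \<bar>f (mix (Suc j) y)\<bar> < \<delta> (Suc j)} = E j"
        using sets.sets_into_space[OF box] by (auto simp: E_def)
      ultimately show ?thesis
        by simp
    qed
    have cover: "{y \<in> PiE {..<l} A. \<bar>f y\<bar> < \<epsilon>} \<subseteq> (\<Union>j<l. E j)"
    proof
      fix y assume y: "y \<in> {y \<in> PiE {..<l} A. \<bar>f y\<bar> < \<epsilon>}"
      have "\<epsilon> \<le> \<delta> l"
        using s False t(1) by (cases "l = 0") (auto simp: \<delta>_def t_def)
      then have "\<bar>f (mix l y)\<bar> < \<delta> l"
        using y mix_l by auto
      moreover have "\<delta> 0 \<le> \<bar>f (mix 0 y)\<bar>"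
        using p(3) t by (simp add: mix_0 \<delta>_def)
      ultimately show "y \<in> (\<Union>j<l. E j)"
        using threshold_crossing[of \<delta> "\<lambda>j. \<bar>f (mix j y)\<bar>" l] y by (auto simp: E_def)
    qed
    have E_le: "emeasure M (E j) \<le> ennreal (C j * t powr \<beta>) * Q" if j: "j < l" for j
      unfolding Q_def
    proof (rule emeasure_le_slices[OF j E _ A])
      fix z assume z: "z \<in> PiE {..<l} A"
      let ?w = "mix j z"
      let ?g = "\<lambda>y. f (?w(j := y))"
      have w: "?w \<in> PiE {..<l} A"
        by (rule mix_A[OF z])
      have wM: "?w \<in> space M"
        using sets.sets_into_space[OF box] w by blast
      have meas: "{y \<in> A j. \<bar>?g y\<bar> < \<delta> (Suc j)} \<in> sets (\<mu> j)"
      proof -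
        have "(\<lambda>y. ?w(j := y)) \<in> measurable (\<mu> j) M"
          using wM j by (intro measurable_fun_upd[where J = "{..<l}"]) auto
        then have [measurable]: "?g \<in> borel_measurable (\<mu> j)"
          using f by (rule measurable_compose)
        have "{y \<in> space (\<mu> j). \<bar>?g y\<bar> < \<delta> (Suc j)} \<in> sets (\<mu> j)"
          by measurable
        then have "A j \<inter> {y \<in> space (\<mu> j). \<bar>?g y\<bar> < \<delta> (Suc j)} \<in> sets (\<mu> j)"
          using A[OF j] by (rule sets.Int[rotated])
        moreover have "A j \<inter> {y \<in> space (\<mu> j). \<bar>?g y\<bar> < \<delta> (Suc j)} = {y \<in> A j. \<bar>?g y\<bar> < \<delta> (Suc j)}"
          using sets.sets_into_space[OF A[OF j]] by auto
        ultimately show ?thesis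
          by simp
      qed
      show "emeasure (\<mu> j) {y \<in> A j. z(j := y) \<in> E j} \<le> ennreal (C j * t powr \<beta>) * emeasure (\<mu> j) (A j)"
      proof (cases "\<delta> j \<le> \<bar>f ?w\<bar>")
        case False
        then have "{y \<in> A j. z(j := y) \<in> E j} = {}"
          by (auto simp: E_def mix_upd)
        then show ?thesis
          by (simp only: emeasure_empty zero_le)
      next
        case True
        \<comment> \<open>The slice through \<open>?w\<close> takes the value \<open>f ?w\<close> at
          \<open>p j\<close>, which lies in the support of the factor, so its sup norm is at least
          \<open>\<delta> j\<close>. The coordinates of \<open>?w\<close> below \<open>j\<close>
          come from \<open>z\<close> and may lie off the supports, which is why \<open>good\<close>
          is required at every point of the box.\<close>
        have "?w j = p j"
          using j by (simp add: mix_def)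
        then have gp: "\<delta> j \<le> \<bar>?g (p j)\<bar>"
          using True fun_upd_triv[of ?w j] by simp
        have "?w \<in> PiE {..<l} W"
          using w AW by (auto simp: PiE_iff)
        from good_onD_point[OF good[OF j this] x[OF j] r sub[OF j] _ p_supp[OF j] gp \<delta> \<delta>, of "Suc j"] pA[OF j] \<alpha>(1)[OF j] \<alpha>(2)
        have "emeasure (\<mu> j) {y \<in> A j. \<bar>?g y\<bar> < \<delta> (Suc j)}
            \<le> ennreal (C j) * ennreal ((\<delta> (Suc j) / \<delta> j) powr \<alpha> j) * emeasure (\<mu> j) (A j)"
          unfolding A_def by (smt (verit) mult_nonneg_nonneg of_nat_0_le_iff)
        also have "\<dots> \<le> ennreal (C j * t powr \<beta>) * emeasure (\<mu> j) (A j)"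
        proof (rule mult_right_mono)
          have "\<delta> (Suc j) / \<delta> j = t powr (1 / l)"
          proof -
            have "t powr (real (Suc j) / l) = t powr (real j / l) * t powr (1 / l)"
              by (simp add: powr_add[symmetric] add_divide_distrib add.commute)
            then show ?thesis
              using s t by (simp add: \<delta>_def)
          qed
          \<comment> \<open>Since \<open>0 < t < 1\<close>, a larger exponent gives a smaller power,
            and \<open>real l * \<beta> \<le> \<alpha> j\<close> pays for the \<open>l\<close>-th
            root.\<close>
          then have "(\<delta> (Suc j) / \<delta> j) powr \<alpha> j = t powr (\<alpha> j / l)"
            by (simp add: powr_powr)
          also have "\<dots> \<le> t powr \<beta>"
            using t j \<alpha>(1)[OF j] by (intro powr_mono') (auto simp: field_simps)
          finally show "ennreal (C j) * ennreal ((\<delta> (Suc j) / \<delta> j) powr \<alpha> j) \<le> ennreal (C j * t powr \<beta>)"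
            using C[OF j] by (simp add: ennreal_mult[symmetric] ennreal_leI)
        qed simp
        finally have "emeasure (\<mu> j) {y \<in> A j. \<bar>?g y\<bar> < \<delta> (Suc j)} \<le> ennreal (C j * t powr \<beta>) * emeasure (\<mu> j) (A j)" .
        moreover have "{y \<in> A j. z(j := y) \<in> E j} \<subseteq> {y \<in> A j. \<bar>?g y\<bar> < \<delta> (Suc j)}"
          using j by (auto simp: E_def mix_Suc_upd)
        ultimately show ?thesis
          using emeasure_mono[OF _ meas] by (meson order.trans)
      qed
    qed (auto simp: E_def)
    have "emeasure M {y \<in> PiE {..<l} A. \<bar>f y\<bar> < \<epsilon>} \<le> emeasure M (\<Union>j<l. E j)"
      using E by (intro emeasure_mono cover) auto
    also have "\<dots> \<le> (\<Sum>j<l. emeasure M (E j))"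
      using E by (intro emeasure_subadditive_finite) auto
    also have "\<dots> \<le> (\<Sum>j<l. ennreal (C j * t powr \<beta>) * Q)"
      by (intro sum_mono E_le) auto
    also have "\<dots> = (\<Sum>j<l. ennreal (C j * t powr \<beta>)) * Q"
      by (rule sum_distrib_right[symmetric])
    also have "(\<Sum>j<l. ennreal (C j * t powr \<beta>)) = ennreal (\<Sum>j<l. C j * t powr \<beta>)"
    proof (rule sum_ennreal)
      fix j assume "j \<in> {..<l}"
      then show "0 \<le> C j * t powr \<beta>"
        using C[of j] by (intro mult_nonneg_nonneg) auto
    qed
    also have "ennreal (\<Sum>j<l. C j * t powr \<beta>) * Q \<le> ennreal ((1 + (\<Sum>i<l. C i)) * t powr \<beta>) * Q"
      by (intro mult_right_mono ennreal_leI) (auto simp: sum_distrib_right[symmetric] distrib_right)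
    finally show ?thesis
      by (simp add: t_def)
  qed
  then show ?thesis
    by (simp add: A_def Q_def)
qed

text \<open>The three factors of the constant come from \<open>good_on_box\<close>, from taking half
  the sup norm as the value \<open>s\<close> exceeded at a point, since the supremum need not be
  attained, and from comparing box and ball by \<open>federer_box\<close>.\<close>

lemma good_on_PiE:
  fixes \<alpha> C :: "nat \<Rightarrow> real"
  assumes f: "f \<in> borel_measurable M"
    and W: "\<And>i. i < l \<Longrightarrow> federer_const_on (X i) (\<mu> i) (D i) (W i) \<and> W i \<subseteq> U i"
    and D: "\<And>i. i < l \<Longrightarrow> 0 < D i"
    and C: "\<And>i. i < l \<Longrightarrow> 0 < C i"
    and \<alpha>: "\<And>i. i < l \<Longrightarrow> real l * \<beta> \<le> \<alpha> i" "0 < \<beta>"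
    and good: "\<And>i z. i < l \<Longrightarrow> z \<in> PiE {..<l} W \<Longrightarrow> good_on (X i) (\<mu> i) (C i) (\<alpha> i) (W i) (\<lambda>y. f (z(i := y)))"
  shows "good_on P M ((1 + (\<Sum>i<l. C i)) * 2 powr \<beta> * (\<Prod>i<l. D i ^ Suc l)) \<beta> (PiE {..<l} W) f"
  unfolding good_on_def
proof (intro ballI allI impI)
  fix x and r \<epsilon> :: real
  assume x: "x \<in> msupport P M" and r: "0 < r" and sub: "mball_of P x r \<subseteq> PiE {..<l} W" and \<epsilon>: "0 < \<epsilon>"
  define V where "V = mball_of P x r"
  define K where "K = 1 + (\<Sum>i<l. C i)"
  define D' where "D' = (\<Prod>i<l. D i ^ Suc l)"
  define Q where "Q = (\<Prod>i<l. emeasure (\<mu> i) (B i (x i) r))"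
  define \<sigma> where "\<sigma> = sup_norm_on P M V f"
  define e where "e = emeasure M {y \<in> V. \<bar>f y\<bar> < \<epsilon>}"
  have K: "0 < K"
    unfolding K_def by (intro add_pos_nonneg sum_nonneg) (use C in \<open>auto intro: less_imp_le\<close>)
  have D': "0 < D'"
    using D by (auto simp: D'_def intro!: prod_pos mult_pos_pos)
  have xP: "x \<in> mspace P"
    using x PiE_U_subset by (auto simp: msupport_def space_M)
  have xi: "x i \<in> msupport (X i) (\<mu> i)" if "i < l" for i
    using x that by (auto simp: msupport_M PiE_iff)
  have Wi: "B i (x i) r \<subseteq> W i" if "i < l" for i
    by (rule mball_subset_of_P[OF xP that sub])
  have WU: "W i \<subseteq> U i" if "i < l" for i
    using W[OF that] by blast
  have "PiE {..<l} W \<subseteq> PiE {..<l} U"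
    using WU by (intro PiE_mono) auto
  then have VU: "V \<inter> PiE {..<l} U = V"
    using sub by (auto simp: V_def)
  have Vpos: "0 < emeasure M V"
    using x r VU unfolding msupport_def space_M V_def by force
  have "Q \<le> (\<Prod>i<l. emeasure (\<mu> i) (B i (x i) (3 * r) \<inter> U i))"
    unfolding Q_def
  proof (rule prod_mono_ennreal)
    fix i assume "i \<in> {..<l}"
    then show "emeasure (\<mu> i) (B i (x i) r) \<le> emeasure (\<mu> i) (B i (x i) (3 * r) \<inter> U i)"
      using Wi[of i] WU[of i] mball_of_mono[of r "3 * r" "X i" "x i"] r by (intro emeasure_mono sets_ball) auto
  qed
  moreover note federer_box[OF W x r sub D]
  ultimately have Q: "Q \<le> ennreal D' * emeasure M V" "Q < \<infinity>"
    using VU by (auto simp: V_def D'_def intro: order.trans order.strict_trans1)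
  have Vbox: "V \<subseteq> PiE {..<l} (\<lambda>i. B i (x i) r)"
    unfolding V_def by (rule mball_P_subset)
  have key: "e \<le> ennreal (K * (\<epsilon> / s) powr \<beta>) * Q" if s: "0 < s" "ennreal s < \<sigma>" for s
  proof -
    obtain p where p: "p \<in> V" "p \<in> msupport P M" "ennreal s < ennreal \<bar>f p\<bar>"
      using s(2) unfolding \<sigma>_def sup_norm_on_def less_SUP_iff by blast
    have "s \<le> \<bar>f p\<bar>"
      using p(3) s(1) by (simp add: ennreal_less_iff)
    have "{y \<in> PiE {..<l} (\<lambda>i. B i (x i) r). \<bar>f y\<bar> < \<epsilon>} \<in> sets M"
    proof -
      have "PiE {..<l} (\<lambda>i. B i (x i) r \<inter> U i) = PiE {..<l} (\<lambda>i. B i (x i) r)"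
        using Wi WU by (intro PiE_cong) blast
      then have box: "PiE {..<l} (\<lambda>i. B i (x i) r) \<in> sets M"
        using sets_box_M[of x r] by simp
      note [measurable] = f
      have "{y \<in> space M. \<bar>f y\<bar> < \<epsilon>} \<in> sets M"
        by measurable
      then have "PiE {..<l} (\<lambda>i. B i (x i) r) \<inter> {y \<in> space M. \<bar>f y\<bar> < \<epsilon>} \<in> sets M"
        using box by (rule sets.Int[rotated])
      moreover have "PiE {..<l} (\<lambda>i. B i (x i) r) \<inter> {y \<in> space M. \<bar>f y\<bar> < \<epsilon>} =
          {y \<in> PiE {..<l} (\<lambda>i. B i (x i) r). \<bar>f y\<bar> < \<epsilon>}"
        using sets.sets_into_space[OF box] by auto
      ultimately show ?thesis
        by simp
    qed
    then have "e \<le> emeasure M {y \<in> PiE {..<l} (\<lambda>i. B i (x i) r). \<bar>f y\<bar> < \<epsilon>}"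
      unfolding e_def using Vbox by (intro emeasure_mono) auto
    also have "\<dots> \<le> ennreal (K * (\<epsilon> / s) powr \<beta>) * Q"
      unfolding K_def Q_def using p(1) Vbox
      by (intro good_on_box[OF f WU C \<alpha> good xi r Wi _ p(2) \<open>s \<le> \<bar>f p\<bar>\<close> s(1) \<epsilon>]) auto
    finally show ?thesis .
  qed
  have "e \<le> ennreal (K * 2 powr \<beta> * D') * ennpowr (ennreal \<epsilon> / \<sigma>) \<beta> * emeasure M V"
  proof (cases "\<sigma> = 0 \<or> \<sigma> = \<infinity>")
    case True
    then show ?thesis
    proof
      \<comment> \<open>The right-hand side is infinite: the ball, centred in the support, has
        positive measure, and the constant is positive.\<close>
      assume "\<sigma> = 0"
      then have "ennpowr (ennreal \<epsilon> / \<sigma>) \<beta> = \<infinity>"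
        using \<epsilon> by (simp add: ennpowr_def divide_ennreal_def ennreal_mult_top)
      then show ?thesis
        using K D' Vpos by (simp add: ennreal_mult_top ennreal_top_mult)
    next
      \<comment> \<open>The right-hand side is zero, so \<open>e\<close> has to vanish.
        \<open>key\<close> now holds for every positive \<open>s\<close> and \<open>Q\<close> is
        finite, so letting \<open>s\<close> grow bounds \<open>e\<close> by any positive
        \<eta>.\<close>
      assume \<sigma>: "\<sigma> = \<infinity>"
      obtain q where q: "Q = ennreal q" "0 \<le> q"
        using Q(2) by (cases Q) auto
      have small: "e \<le> 0 + ennreal \<eta>" if \<eta>: "0 < \<eta>" for \<eta>
      proof -
        \<comment> \<open>\<open>s\<close> is chosen next so that
          \<open>(\<epsilon> / s) powr \<beta>\<close> equals \<tau>, and then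
          \<open>K * \<tau> * q\<close> is at most \<eta>; adding 1 keeps the denominator positive
          when \<open>q = 0\<close>.\<close>
        define \<tau> where "\<tau> = \<eta> / (K * q + 1)"
        have \<tau>: "0 < \<tau>"
          using \<eta> K q(2) by (simp add: \<tau>_def add_nonneg_pos)
        define s where "s = \<epsilon> / \<tau> powr (1 / \<beta>)"
        have s: "0 < s"
          using \<epsilon> \<tau> by (simp add: s_def)
        have "(\<epsilon> / s) powr \<beta> = \<tau>"
          using \<epsilon> \<tau> \<alpha>(2) by (simp add: s_def powr_powr)
        then have "e \<le> ennreal (K * \<tau>) * ennreal q"
          using key[OF s] \<sigma> q by simp
        also have "\<dots> = ennreal (K * \<tau> * q)"
          using K \<tau> q(2) by (simp add: ennreal_mult)
        also have "\<dots> \<le> ennreal \<eta>"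
        proof (rule ennreal_leI)
          have "K * q * \<tau> \<le> (K * q + 1) * \<tau>"
            using \<tau> by (intro mult_right_mono) auto
          also have "\<dots> = \<eta>"
            using K q(2) by (simp add: \<tau>_def add_nonneg_eq_0_iff)
          finally show "K * \<tau> * q \<le> \<eta>"
            by (simp add: mult_ac)
        qed
        finally show ?thesis
          by simp
      qed
      have "e \<le> 0"
        by (rule ennreal_le_epsilon) (rule small)
      then show ?thesis
        by simp
    qed
  next
    case False
    then obtain \<sigma>' where \<sigma>': "\<sigma> = ennreal \<sigma>'" "0 < \<sigma>'"
      by (cases \<sigma>) auto
    have "e \<le> ennreal (K * (\<epsilon> / (\<sigma>' / 2)) powr \<beta>) * Q"
      using \<sigma>' by (intro key) (auto simp: ennreal_less_iff)
    also have "(\<epsilon> / (\<sigma>' / 2)) powr \<beta> = 2 powr \<beta> * (\<epsilon> / \<sigma>') powr \<beta>"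
      using \<epsilon> \<sigma>'(2) powr_mult[of 2 "\<epsilon> / \<sigma>'" \<beta>] by (simp add: mult.commute)
    also have "ennreal (K * (2 powr \<beta> * (\<epsilon> / \<sigma>') powr \<beta>)) * Q
        \<le> ennreal (K * (2 powr \<beta> * (\<epsilon> / \<sigma>') powr \<beta>)) * (ennreal D' * emeasure M V)"
      by (intro mult_left_mono Q(1)) simp
    also have "\<dots> = ennreal (K * 2 powr \<beta> * D' * (\<epsilon> / \<sigma>') powr \<beta>) * emeasure M V"
      using K D' by (simp add: mult.assoc[symmetric] ennreal_mult[symmetric]) (simp add: mult_ac)
    also have "\<dots> = ennreal (K * 2 powr \<beta> * D') * ennpowr (ennreal \<epsilon> / \<sigma>) \<beta> * emeasure M V"
      using K D' \<epsilon> \<sigma>' by (simp add: divide_ennreal ennpowr_ennreal ennreal_mult)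
    finally show ?thesis .
  qed
  then show "emeasure M {y \<in> mball_of P x r. \<bar>f y\<bar> < \<epsilon>}
      \<le> ennreal ((1 + (\<Sum>i<l. C i)) * 2 powr \<beta> * (\<Prod>i<l. D i ^ Suc l)) *
        ennpowr (ennreal \<epsilon> / sup_norm_on P M (mball_of P x r) f) \<beta> * emeasure M (mball_of P x r)"
    by (simp add: e_def K_def D'_def \<sigma>_def V_def)
qed

end

section \<open>Stacked maps\<close>

text \<open>By the Leibniz formula a minor is a polynomial in the entries.\<close>

lemma minor_borel_measurable:
  fixes F :: "'a \<Rightarrow> real mat"
  assumes F: "\<And>x. x \<in> space N \<Longrightarrow> F x \<in> carrier_mat m n"
    and meas: "\<And>r c. r < m \<Longrightarrow> c < n \<Longrightarrow> (\<lambda>x. F x $$ (r, c)) \<in> borel_measurable N"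
    and k: "k \<in> minor_index m n"
  shows "(\<lambda>x. minor (F x) k) \<in> borel_measurable N"
proof -
  obtain I J where IJ: "k = (I, J)" "I \<subseteq> {..<m}" "J \<subseteq> {..<n}" "card I = card J"
    using k by (auto simp: minor_index_def)
  have pick: "pick I a < m" "pick J a < n" if "a < card I" for a
    using IJ that pick_in_set_le[of a I] pick_in_set_le[of a J] by auto
  have "(\<lambda>x. \<Sum>p | p permutes {0..<card I}. signof p * (\<Prod>a = 0..<card I. F x $$ (pick I a, pick J (p a))))
      \<in> borel_measurable N"
    using meas pick
    by (intro borel_measurable_sum borel_measurable_times borel_measurable_prod borel_measurable_const)
      (auto simp: permutes_in_image)
  also have "?this \<longleftrightarrow> ?thesis"
  proof (rule measurable_cong)
    fix x assume "x \<in> space N"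
    then have x: "F x \<in> carrier_mat m n"
      by (rule F)
    then have dims: "{i. i < dim_row (F x) \<and> i \<in> I} = I" "{i. i < dim_col (F x) \<and> i \<in> J} = J"
      using IJ by auto
    then have carr: "submatrix (F x) I J \<in> carrier_mat (card I) (card I)"
      using IJ(4) by (intro carrier_matI) (simp_all add: dim_submatrix)
    have "minor (F x) k = Determinant.det (submatrix (F x) I J)"
      by (simp add: minor_def IJ)
    also have "\<dots> = (\<Sum>p | p permutes {0..<card I}. signof p * (\<Prod>a = 0..<card I. submatrix (F x) I J $$ (a, p a)))"
      by (rule det_def'[OF carr])
    also have "\<dots> = (\<Sum>p | p permutes {0..<card I}. signof p * (\<Prod>a = 0..<card I. F x $$ (pick I a, pick J (p a))))"
    proof (intro sum.cong prod.cong refl arg_cong2[where f = "(*)"])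
      fix p a assume "p \<in> {p. p permutes {0..<card I}}" "a \<in> {0..<card I}"
      then have "a < card I" "p a < card J"
        using permutes_in_image[of p "{0..<card I}" a] IJ(4) by auto
      then show "submatrix (F x) I J $$ (a, p a) = F x $$ (pick I a, pick J (p a))"
        using submatrix_index[of a "F x" I "p a" J] dims by simp
    qed
    finally show "(\<Sum>p | p permutes {0..<card I}. signof p * (\<Prod>a = 0..<card I. F x $$ (pick I a, pick J (p a)))) = minor (F x) k"
      by simp
  qed
  finally show ?thesis .
qed

locale radon_product_maps = radon_product l X U \<mu>
  for l and X :: "nat \<Rightarrow> 'a::polish_space metric" and U \<mu> +
  fixes m :: "nat \<Rightarrow> nat" and n :: nat and F :: "nat \<Rightarrow> 'a \<Rightarrow> real mat"
  assumes continuous: "i < l \<Longrightarrow> continuous_mat_on (X i) (U i) (m i) n (F i)"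
begin

definition G :: "(nat \<Rightarrow> 'a) \<Rightarrow> real mat" where
  "G x = stack_rows n (map (\<lambda>i. F i (x i)) [0..<l])"

lemma F_carrier: "i < l \<Longrightarrow> y \<in> U i \<Longrightarrow> F i y \<in> carrier_mat (m i) n"
  using continuous[of i] by (auto simp: continuous_mat_on_def)

lemma G_carrier: "x \<in> PiE {..<l} U \<Longrightarrow> G x \<in> carrier_mat (\<Sum>i<l. m i) n"
  unfolding G_def by (intro stack_rows_map_carrier F_carrier) auto

lemma F_entry_measurable:
  assumes "i < l" "r < m i" "c < n"
  shows "(\<lambda>y. F i y $$ (r, c)) \<in> borel_measurable (\<mu> i)"
proof -
  have "continuous_map (subtopology (mtopology_of (X i)) (U i)) euclideanreal (\<lambda>y. F i y $$ (r, c))"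
    using continuous[of i] assms by (auto simp: continuous_mat_on_def)
  then have "continuous_on (U i) (\<lambda>y. F i y $$ (r, c))"
    using U_subset[OF assms(1)] by (simp add: top[OF assms(1)] subtopology_subtopology Int_absorb1)
  then have "(\<lambda>y. F i y $$ (r, c)) \<in> borel_measurable (restrict_space borel (U i))"
    by (rule borel_measurable_continuous_on_restrict)
  then show ?thesis
    using measurable_cong_sets[OF sets_mu[of i] refl] assms(1) by blast
qed

lemma G_entry_measurable:
  assumes r: "r < (\<Sum>i<l. m i)" and c: "c < n"
  shows "(\<lambda>x. G x $$ (r, c)) \<in> borel_measurable M"
proof -
  obtain j r' where j: "j < l" "r' < m j" "r = (\<Sum>i<j. m i) + r'"
    using lessThan_sum_cases[OF r] by blast
  have "(\<lambda>x. F j (x j) $$ (r', c)) \<in> borel_measurable M"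
    using j(1) by (intro measurable_compose[OF _ F_entry_measurable[OF j(1,2) c]] measurable_component_singleton) simp
  also have "?this \<longleftrightarrow> ?thesis"
  proof (rule measurable_cong)
    fix x assume "x \<in> space M"
    then have "x \<in> PiE {..<l} U"
      by (simp add: space_M)
    then show "F j (x j) $$ (r', c) = G x $$ (r, c)"
      unfolding G_def j(3) using j c by (subst stack_rows_index[of l _ m]) (auto intro: F_carrier)
  qed
  finally show ?thesis .
qed

lemma affine_combination_measurable:
  "(\<lambda>x. c0 + (\<Sum>k\<in>minor_index (\<Sum>i<l. m i) n. c k * minor (G x) k)) \<in> borel_measurable M"
  by (intro borel_measurable_add borel_measurable_sum borel_measurable_times borel_measurable_const
      minor_borel_measurable[where m = "\<Sum>i<l. m i" and n = n] G_entry_measurable)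
    (auto simp: space_M intro: G_carrier)

text \<open>Freezing all blocks except the \<open>i\<close>-th leaves a function affine in the
  minors of that block. The coefficients depend on \<open>z\<close>, which is harmless because the
  goodness constants of \<open>F i\<close> are common to all coefficients.\<close>

lemma slice_affine_combination:
  assumes z: "z \<in> PiE {..<l} U" and i: "i < l"
  shows "\<exists>c0' c'. \<forall>y\<in>U i. c0 + (\<Sum>k\<in>minor_index (\<Sum>i<l. m i) n. c k * minor (G (z(i := y))) k)
    = c0' + (\<Sum>k\<in>minor_index (m i) n. c' k * minor (F i y) k)"
proof -
  have Y: "F j (z j) \<in> carrier_mat (m j) n" if "j < l" for j
    using z that by (intro F_carrier) auto
  have "affine_in_minors (m i) n (\<lambda>Z. c0 + (\<Sum>k\<in>minor_index (\<Sum>i<l. m i) n.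
      c k * minor (stack_rows n (map ((\<lambda>j. F j (z j))(i := Z)) [0..<l])) k))"
    by (intro affine_in_minors_add affine_in_minors_const affine_in_minors_sum affine_in_minors_cmult
        affine_in_minors_stack_rows Y i)
  moreover have "stack_rows n (map ((\<lambda>j. F j (z j))(i := F i y)) [0..<l]) = G (z(i := y))" for y
    unfolding G_def by (rule arg_cong[where f = "stack_rows n"]) (auto intro: map_cong)
  ultimately obtain c0' c' where "\<forall>y\<in>U i. c0 + (\<Sum>k\<in>minor_index (\<Sum>i<l. m i) n. c k * minor (G (z(i := y))) k)
    = c0' + (\<Sum>k\<in>minor_index (m i) n. c' k * minor (F i y) k)"
    unfolding affine_in_minors_def using F_carrier[OF i] by fastforce
  then show ?thesis
    by blast
qed

lemma good_map_product:
  assumes fed: "\<And>i. i < l \<Longrightarrow> federer_measure_on (X i) (U i) (\<mu> i)"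
    and good: "\<And>i. i < l \<Longrightarrow> good_map (X i) (\<mu> i) (m i) n (F i)"
  shows "good_map P M (\<Sum>i<l. m i) n G"
proof -
  \<comment> \<open>Federer and goodness data live on different neighbourhoods; \<open>nice\<close>
    records a common one, since \<open>good_on_PiE\<close> needs both on the same
    \<open>W i\<close>.\<close>
  define nice where "nice = (\<lambda>i W D C \<alpha>. openin (mtopology_of (X i)) W \<and> W \<subseteq> U i \<and> 0 < D \<and> 0 < C \<and> 0 < \<alpha> \<and>
      federer_const_on (X i) (\<mu> i) D W \<and>
      (\<forall>c0 c. good_on (X i) (\<mu> i) C \<alpha> W (\<lambda>y. c0 + (\<Sum>k\<in>minor_index (m i) n. c k * minor (F i y) k))))"
  have "AE x in \<mu> i. \<exists>W D C \<alpha>. x \<in> W \<and> nice i W D C \<alpha>" if i: "i < l" for i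
  proof -
    have "AE x in \<mu> i. \<exists>W D. openin (mtopology_of (X i)) W \<and> x \<in> W \<and> W \<subseteq> U i \<and> D > 0 \<and>
        federer_const_on (X i) (\<mu> i) D W"
      using fed[OF i] by (simp add: federer_measure_on_def)
    moreover have "AE x in \<mu> i. \<exists>W C \<alpha>. openin (mtopology_of (X i)) W \<and> x \<in> W \<and> W \<subseteq> space (\<mu> i) \<and> C > 0 \<and> \<alpha> > 0 \<and>
        (\<forall>c0 c. good_on (X i) (\<mu> i) C \<alpha> W (\<lambda>y. c0 + (\<Sum>k\<in>minor_index (m i) n. c k * minor (F i y) k)))"
      using good[OF i] by (simp add: good_map_def good_tuple_def)
    ultimately show ?thesis
    proof eventually_elim
      case (elim x)
      then obtain W1 D W2 C \<alpha> where
        1: "openin (mtopology_of (X i)) W1" "x \<in> W1" "W1 \<subseteq> U i" "D > 0" "federer_const_on (X i) (\<mu> i) D W1" and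
        2: "openin (mtopology_of (X i)) W2" "x \<in> W2" "C > 0" "\<alpha> > 0"
          "\<And>c0 c. good_on (X i) (\<mu> i) C \<alpha> W2 (\<lambda>y. c0 + (\<Sum>k\<in>minor_index (m i) n. c k * minor (F i y) k))"
        by blast
      have "nice i (W1 \<inter> W2) D C \<alpha>"
        unfolding nice_def
      proof (intro conjI allI)
        show "federer_const_on (X i) (\<mu> i) D (W1 \<inter> W2)"
          by (rule federer_const_on_subset[OF 1(5)]) simp
        show "good_on (X i) (\<mu> i) C \<alpha> (W1 \<inter> W2) (\<lambda>y. c0 + (\<Sum>k\<in>minor_index (m i) n. c k * minor (F i y) k))" for c0 c
          by (rule good_on_subset[OF 2(5)]) simp
      qed (use 1 2 in auto)
      then show ?case
        using 1(2) 2(2) by blast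
    qed
  qed
  then have "AE x in M. \<forall>i<l. \<exists>W D C \<alpha>. x i \<in> W \<and> nice i W D C \<alpha>"
    by (rule AE_PiM_all)
  moreover have "AE x in M. x \<in> space M"
    by (rule AE_space)
  ultimately have "AE x in M. \<exists>W C \<alpha>. openin (mtopology_of P) W \<and> x \<in> W \<and> W \<subseteq> space M \<and> C > 0 \<and> \<alpha> > 0 \<and>
      (\<forall>c0 c. good_on P M C \<alpha> W (\<lambda>y. c0 + (\<Sum>k\<in>minor_index (\<Sum>i<l. m i) n. c k * minor (G y) k)))"
  proof eventually_elim
    case (elim x)
    then obtain W D C \<alpha> where nice: "\<And>i. i < l \<Longrightarrow> x i \<in> W i \<and> nice i (W i) (D i) (C i) (\<alpha> i)"
      by metis
    then have W: "\<And>i. i < l \<Longrightarrow> openin (mtopology_of (X i)) (W i)" "\<And>i. i < l \<Longrightarrow> W i \<subseteq> U i"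
      and D: "\<And>i. i < l \<Longrightarrow> 0 < D i" and C: "\<And>i. i < l \<Longrightarrow> 0 < C i" and \<alpha>: "\<And>i. i < l \<Longrightarrow> 0 < \<alpha> i"
      and F: "\<And>i. i < l \<Longrightarrow> federer_const_on (X i) (\<mu> i) (D i) (W i)"
      and g: "\<And>i c0 c. i < l \<Longrightarrow> good_on (X i) (\<mu> i) (C i) (\<alpha> i) (W i)
        (\<lambda>y. c0 + (\<Sum>k\<in>minor_index (m i) n. c k * minor (F i y) k))"
      by (simp_all add: nice_def)
    \<comment> \<open>The denominator \<open>real l + 1\<close> yields
      \<open>real l * \<beta> \<le> \<alpha> i\<close> without dividing by zero, and the inserted 1
      keeps the minimum defined when \<open>l = 0\<close>.\<close>
    define \<beta> where "\<beta> = Min (insert 1 (\<alpha> ` {..<l})) / (real l + 1)"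
    have Min_pos: "0 < Min (insert 1 (\<alpha> ` {..<l}))"
      using \<alpha> by (subst Min_gr_iff) auto
    then have \<beta>: "0 < \<beta>"
      by (simp add: \<beta>_def)
    have \<beta>_le: "real l * \<beta> \<le> \<alpha> i" if "i < l" for i
    proof -
      have "real l * \<beta> \<le> (real l + 1) * \<beta>"
        using \<beta> by simp
      also have "\<dots> = Min (insert 1 (\<alpha> ` {..<l}))"
        by (simp add: \<beta>_def)
      also have "\<dots> \<le> \<alpha> i"
        using that by (intro Min_le) auto
      finally show ?thesis .
    qed
    have WU: "PiE {..<l} W \<subseteq> PiE {..<l} U"
      using W(2) by (intro PiE_mono) auto
    define C' where "C' = (1 + (\<Sum>i<l. C i)) * 2 powr \<beta> * (\<Prod>i<l. D i ^ Suc l)"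
    have "0 < C'"
      unfolding C'_def
      by (intro mult_pos_pos add_pos_nonneg sum_nonneg prod_pos ballI zero_less_power)
        (use C D in \<open>auto intro: less_imp_le\<close>)
    moreover have "good_on P M C' \<beta> (PiE {..<l} W) (\<lambda>y. c0 + (\<Sum>k\<in>minor_index (\<Sum>i<l. m i) n. c k * minor (G y) k))" for c0 c
      unfolding C'_def
    proof (rule good_on_PiE[OF affine_combination_measurable _ D C \<beta>_le \<beta>])
      show "federer_const_on (X i) (\<mu> i) (D i) (W i) \<and> W i \<subseteq> U i" if "i < l" for i
        using F W that by simp
      fix i z assume i: "i < l" and z: "z \<in> PiE {..<l} W"
      obtain c0' c' where c': "\<And>y. y \<in> U i \<Longrightarrow> c0 + (\<Sum>k\<in>minor_index (\<Sum>i<l. m i) n. c k * minor (G (z(i := y))) k)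
          = c0' + (\<Sum>k\<in>minor_index (m i) n. c' k * minor (F i y) k)"
        using slice_affine_combination[OF _ i, of z c0 c] z WU by blast
      show "good_on (X i) (\<mu> i) (C i) (\<alpha> i) (W i)
          (\<lambda>y. c0 + (\<Sum>k\<in>minor_index (\<Sum>i<l. m i) n. c k * minor (G (z(i := y))) k))"
        by (rule good_on_cong[OF g[OF i, of c0' c']]) (use c' W(2)[OF i] in blast)
    qed
    moreover have "x \<in> PiE {..<l} W"
      using elim(2) nice by (auto simp: space_M PiE_iff)
    moreover have "openin (mtopology_of P) (PiE {..<l} W)"
      using W(1) by (rule openin_PiE)
    ultimately show ?case
      using \<beta> WU unfolding space_M by blast
  qed
  then show ?thesis
    unfolding good_map_def good_tuple_def .
qed

lemma federer_product:
  assumes fed: "\<And>i. i < l \<Longrightarrow> federer_measure_on (X i) (U i) (\<mu> i)"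
  shows "federer_measure_on P (PiE {..<l} U) M"
proof -
  have "AE x in \<mu> i. \<exists>W D. openin (mtopology_of (X i)) W \<and> x \<in> W \<and> W \<subseteq> U i \<and> D > 0 \<and>
      federer_const_on (X i) (\<mu> i) D W" if "i < l" for i
    using fed[OF that] by (simp add: federer_measure_on_def)
  then have "AE x in M. \<forall>i<l. \<exists>W D. openin (mtopology_of (X i)) W \<and> x i \<in> W \<and> W \<subseteq> U i \<and> D > 0 \<and>
      federer_const_on (X i) (\<mu> i) D W"
    by (rule AE_PiM_all)
  moreover have "AE x in M. x \<in> space M"
    by (rule AE_space)
  ultimately have "AE x in M. \<exists>W D. openin (mtopology_of P) W \<and> x \<in> W \<and> W \<subseteq> PiE {..<l} U \<and> D > 0 \<and>
      federer_const_on P M D W"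
  proof eventually_elim
    case (elim x)
    then obtain W D where W: "\<And>i. i < l \<Longrightarrow> openin (mtopology_of (X i)) (W i) \<and> x i \<in> W i \<and> W i \<subseteq> U i \<and> D i > 0 \<and>
        federer_const_on (X i) (\<mu> i) (D i) (W i)"
      by metis
    have "openin (mtopology_of P) (PiE {..<l} W)"
      using W by (intro openin_PiE) auto
    moreover have "x \<in> PiE {..<l} W"
      using elim(2) W by (auto simp: space_M PiE_iff)
    moreover have "PiE {..<l} W \<subseteq> PiE {..<l} U"
      using W by (intro PiE_mono) auto
    moreover have "0 < (\<Prod>i<l. D i ^ Suc l) + 1"
      using W by (intro add_nonneg_pos prod_nonneg ballI zero_le_power) (auto intro: less_imp_le)
    moreover have "federer_const_on P M ((\<Prod>i<l. D i ^ Suc l) + 1) (PiE {..<l} W)"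
      using W by (intro federer_const_on_PiE) auto
    ultimately show ?case
      by blast
  qed
  then show ?thesis
    using radon_M by (simp add: federer_measure_on_def)
qed

text \<open>Applied to the values of \<open>F i\<close> at support points of small factor balls,
  \<open>exists_stack_rows_det_nonzero\<close> yields a stacked value off the hypersurface. It is
  attained at a support point of the product, whose support is the product of the supports.\<close>

lemma weakly_nonplanar_product:
  assumes np: "\<And>i. i < l \<Longrightarrow> weakly_nonplanar (X i) (\<mu> i) (m i) n (F i)"
  shows "weakly_nonplanar P M (\<Sum>i<l. m i) n G"
  unfolding weakly_nonplanar_def
proof (intro ballI allI impI)
  fix x and r :: real and H
  assume x: "x \<in> msupport P M" and r: "0 < r" and sub: "mball_of P x r \<subseteq> space M"
    and H: "H \<in> det_hypersurfaces (\<Sum>i<l. m i) n"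
  obtain A B where AB: "H = det_hypersurface (\<Sum>i<l. m i) n A B" "A \<in> carrier_mat n (\<Sum>i<l. m i)" "B \<in> carrier_mat n n"
    "vec_space.rank n (append_cols A B) = n"
    using H unfolding det_hypersurfaces_def by blast
  have xP: "x \<in> mspace P"
    using x PiE_U_subset by (auto simp: msupport_def space_M)
  have xi: "x i \<in> msupport (X i) (\<mu> i)" if "i < l" for i
    using x that by (auto simp: msupport_M PiE_iff)
  \<comment> \<open>Factor balls whose product lies in the given ball, so that points chosen
    independently in the factors combine to a point of that ball.\<close>
  define V where "V = (\<lambda>i. mball_of (X i) (x i) (r / 3 ^ l))"
  have VU: "V i \<subseteq> U i" if "i < l" for i
  proof -
    have "mball_of (X i) (x i) r \<subseteq> U i"
      by (rule mball_subset_of_P[OF xP that]) (use sub space_M in simp)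
    moreover have "r / 3 ^ l \<le> r"
      using r one_le_power[of "3 :: real" l] by (simp add: divide_le_eq mult_le_cancel_left1)
    ultimately show ?thesis
      unfolding V_def using mball_of_mono[of "r / 3 ^ l" r "X i" "x i"] by blast
  qed
  define Q where "Q = (\<lambda>i. F i ` (V i \<inter> msupport (X i) (\<mu> i)))"
  have ms: "sum_list (map m [0..<l]) = (\<Sum>i<l. m i)"
    by (simp add: interv_sum_list_conv_sum_set_nat atLeast0LessThan)
  have "list_all2 (\<lambda>m Q. Q \<subseteq> carrier_mat m n \<and> (\<forall>H\<in>det_hypersurfaces m n. \<not> Q \<subseteq> H)) (map m [0..<l]) (map Q [0..<l])"
    unfolding list_all2_conv_all_nth
  proof (intro conjI allI impI)
    fix i assume "i < length (map m [0..<l])"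
    then have i: "i < l" and nth: "map m [0..<l] ! i = m i" "map Q [0..<l] ! i = Q i"
      by auto
    show "map Q [0..<l] ! i \<subseteq> carrier_mat (map m [0..<l] ! i) n"
      unfolding nth unfolding Q_def using F_carrier[OF i] VU[OF i] by blast
    have "0 < r / 3 ^ l" "mball_of (X i) (x i) (r / 3 ^ l) \<subseteq> space (\<mu> i)"
      using r VU[OF i] i by (simp_all add: V_def space_mu)
    then show "\<forall>H\<in>det_hypersurfaces (map m [0..<l] ! i) n. \<not> map Q [0..<l] ! i \<subseteq> H"
      using np[OF i] xi[OF i] unfolding nth unfolding Q_def V_def weakly_nonplanar_def by blast
  qed simp
  moreover have "\<exists>Z\<in>carrier_mat (\<Sum>i<l. m i) n. Determinant.det (A * Z + B) \<noteq> 0"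
    using AB full_rank_append_cols_iff[OF AB(2,3)] by blast
  ultimately obtain Ys where Ys: "list_all2 (\<in>) Ys (map Q [0..<l])" "Determinant.det (A * stack_rows n Ys + B) \<noteq> 0"
    using exists_stack_rows_det_nonzero[of n "map m [0..<l]" "map Q [0..<l]" A B] AB(2,3) unfolding ms by blast
  have nth: "Ys ! i \<in> Q i" if "i < l" for i
    using Ys(1) that by (auto simp: list_all2_conv_all_nth)
  have len: "length Ys = l"
    using Ys(1) by (auto simp: list_all2_conv_all_nth)
  obtain y where y: "\<And>i. i < l \<Longrightarrow> y i \<in> V i \<inter> msupport (X i) (\<mu> i) \<and> F i (y i) = Ys ! i"
    using nth unfolding Q_def image_iff by metis
  \<comment> \<open>Points of the product are extensional functions, so the values of
    \<open>y\<close> from \<open>l\<close> on are reset to \<open>undefined\<close>.\<close>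
  define y' where "y' = restrict y {..<l}"
  have "map (\<lambda>i. F i (y' i)) [0..<l] = Ys"
    by (rule nth_equalityI) (use y len in \<open>auto simp: y'_def\<close>)
  then have G: "G y' = stack_rows n Ys"
    by (simp add: G_def)
  have "y' \<in> PiE {..<l} V"
    using y by (auto simp: y'_def)
  then have "y' \<in> mball_of P x r"
    using box_subset_mball_P[OF xP r] unfolding V_def by blast
  moreover have "y' \<in> msupport P M"
    using y by (auto simp: msupport_M y'_def)
  moreover have "G y' \<notin> H"
    using Ys(2) unfolding AB(1) det_hypersurface_def G by simp
  ultimately show "\<not> G ` (mball_of P x r \<inter> msupport P M) \<subseteq> H"
    by blast
qed

end

theorem theorem5p6:
  fixes l n :: nat
    and d m :: "nat \<Rightarrow> nat"
    and U :: "nat \<Rightarrow> (nat \<Rightarrow> real) set"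
    and F :: "nat \<Rightarrow> (nat \<Rightarrow> real) \<Rightarrow> real mat"
    and \<mu> :: "nat \<Rightarrow> (nat \<Rightarrow> real) measure"
  assumes "\<And>i. i < l \<Longrightarrow> openin (mtopology_of (euclid (d i))) (U i)"
    and "\<And>i. i < l \<Longrightarrow> continuous_mat_on (euclid (d i)) (U i) (m i) n (F i)"
    and "\<And>i. i < l \<Longrightarrow> federer_measure_on (euclid (d i)) (U i) (\<mu> i)"
    and "\<And>i. i < l \<Longrightarrow> good_map (euclid (d i)) (\<mu> i) (m i) n (F i)"
    and "\<And>i. i < l \<Longrightarrow> weakly_nonplanar (euclid (d i)) (\<mu> i) (m i) n (F i)"
  defines "M \<equiv> \<Pi>\<^sub>M i\<in>{..<l}. \<mu> i"
    and "G \<equiv> \<lambda>x. stack_rows n (map (\<lambda>i. F i (x i)) [0..<l])"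
  shows "federer_measure_on (euclid_prod l d) (\<Pi>\<^sub>E i\<in>{..<l}. U i) M
       \<and> good_map (euclid_prod l d) M (\<Sum>i<l. m i) n G
       \<and> weakly_nonplanar (euclid_prod l d) M (\<Sum>i<l. m i) n G"
proof -
  interpret R: radon_product_maps l "\<lambda>i. euclid (d i)" U \<mu> m n F
  proof
    fix i assume i: "i < l"
    show "mtopology_of (euclid (d i)) = top_of_set (mspace (euclid (d i)))"
      by (rule mtopology_of_euclid)
    show "mspace (euclid (d i)) \<in> sets borel"
      by (rule euclid_borel)
    show "radon_measure_on (euclid (d i)) (U i) (\<mu> i)"
      using assms(3)[OF i] by (simp add: federer_measure_on_def)
  qed (fact assms(1,2))+
  have "G = R.G"
    by (simp add: fun_eq_iff G_def R.G_def)
  then show ?thesis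
    using R.federer_product[OF assms(3)] R.good_map_product[OF assms(3,4)] R.weakly_nonplanar_product[OF assms(5)]
    unfolding euclid_prod_def M_def by simp
qed

end
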